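(* There exists a positive quantum graph $x \in \mathcal{A}_{\emptyset}$ which cannot be expressed as a sum of squares, i.e. there are no finitely many $g_1,\ldots,g_m \in \mathcal{A}$ with $x = \llbracket \sum_{i=1}^m g_i^2 \rrbracket$.
   Context: All graphs are finite and simple; $\emptyset$ denotes the graph with no vertices. For graphs $H,G$, $t(H;G)$ is the probability that a uniformly random map $V(H)\to V(G)$ is a homomorphism (sends edges to edges); $t(\emptyset;G)=1$. A partially labeled graph is a graph in which some vertices carry distinct positive-integer labels (the remaining vertices are unlabeled). $\mathcal{F}$ is the set of partially labeled graphs up to label-preserving isomorphism, and for a finite $L\subset\mathbb{N}$, $\mathcal{F}_L$ is the set of those whose set of labels is exactly $L$. The product $H_1\cdot H_2$ of partially labeled graphs is obtained by taking the disjoint union and identifying vertices with the same label (keeping only one copy of any multiple edge). $\mathbb{R}[\mathcal{F}]$ is the algebra of finite formal real linear combinations of elements of $\mathcal{F}$ with this product extended bilinearly; $\mathbb{R}[\mathcal{F}_L]$ is its subalgebra spanned by $\mathcal{F}_L$; elements of $\mathbb{R}[\mathcal{F}_\emptyset]$ are called quantum graphs. For $H\in\mathcal{F}_L$, a graph $G$ and $\phi:L\to V(G)$, $t(H;G,\phi)$ is the probability that the map $V(H)\to V(G)$ sending each labeled vertex with label $\ell$ to $\phi(\ell)$ and each unlabeled vertex to an independent uniformly random vertex of $G$ is a homomorphism. For $f=\sum_i\alpha_iH_i$ with $L_i$ the label set of $H_i$ and $\phi:\bigcup_i L_i\to V(G)$, $t(f;G,\phi):=\sum_i\alpha_i t(H_i;G,\phi|_{L_i})$.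 Let $\mathcal{K}$ be the ideal of $\mathbb{R}[\mathcal{F}]$ generated by the elements $F-\emptyset$ with $F$ a one-vertex (labeled or unlabeled) graph; set $\mathcal{A}=\mathbb{R}[\mathcal{F}]/\mathcal{K}$ and $\mathcal{A}_L=\mathbb{R}[\mathcal{F}_L]/(\mathcal{K}\cap\mathbb{R}[\mathcal{F}_L])$; $t(\cdot;G,\phi)$ is well defined on these quotients. An element $f\in\mathcal{A}_L$ is positive if $t(f;G,\phi)\ge 0$ for every graph $G$ and every $\phi:L\to V(G)$. For finite $T\subset\mathbb{N}$, $\llbracket\cdot\rrbracket_T$ is the linear map on $\mathbb{R}[\mathcal{F}]$ (and on $\mathcal{A}$) that removes all labels not in $T$ (those vertices become unlabeled); $\llbracket\cdot\rrbracket:=\llbracket\cdot\rrbracket_\emptyset$. *)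

theory Defs
  imports Complex_Main "HOL-Library.FuncSet"
begin

type_synonym plg = "nat set \<times> nat set set \<times> (nat \<rightharpoonup> nat)"

definition pverts :: "plg \<Rightarrow> nat set" where "pverts H = fst H"
definition pedges :: "plg \<Rightarrow> nat set set" where "pedges H = fst (snd H)"
definition plabs :: "plg \<Rightarrow> (nat \<rightharpoonup> nat)" where "plabs H = snd (snd H)"

definition wf_plg :: "plg \<Rightarrow> bool" where
  "wf_plg H \<longleftrightarrow> finite (pverts H)
     \<and> (\<forall>e\<in>pedges H. e \<subseteq> pverts H \<and> card e = 2)
     \<and> finite (dom (plabs H)) \<and> dom (plabs H) \<subseteq> {1..}
     \<and> ran (plabs H) \<subseteq> pverts H \<and> inj_on (plabs H) (dom (plabs H))"

definition plg_iso :: "plg \<Rightarrow> plg \<Rightarrow> bool" where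
  "plg_iso H H' \<longleftrightarrow> (\<exists>\<pi>. bij_betw \<pi> (pverts H) (pverts H')
       \<and> pedges H' = (\<lambda>e. \<pi> ` e) ` pedges H
       \<and> plabs H' = (\<lambda>l. map_option \<pi> (plabs H l)))"

text \<open>A fixed representative of the isomorphism class of H (depends only on the class).\<close>
definition canon :: "plg \<Rightarrow> plg" where
  "canon H = (SOME H'. H' \<in> {K. plg_iso H K})"

definition Fset :: "plg set" where
  "Fset = canon ` {H. wf_plg H}"

definition empty_plg :: plg where "empty_plg = ({}, {}, Map.empty)"

definition one_vertex :: "plg \<Rightarrow> bool" where
  "one_vertex H \<longleftrightarrow> wf_plg H \<and> card (pverts H) = 1"

text \<open>Gluing product: disjoint union, identifying vertices with equal labels,
multiple edges collapse (edge sets are sets).\<close>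
definition glue_map :: "plg \<Rightarrow> plg \<Rightarrow> nat \<Rightarrow> nat" where
  "glue_map H1 H2 v =
     (if \<exists>l. plabs H2 l = Some v \<and> plabs H1 l \<noteq> None
      then the (plabs H1 (THE l. plabs H2 l = Some v))
      else Suc (Max (insert 0 (pverts H1))) + v)"

definition glue :: "plg \<Rightarrow> plg \<Rightarrow> plg" where
  "glue H1 H2 =
     (pverts H1 \<union> glue_map H1 H2 ` pverts H2,
      pedges H1 \<union> (\<lambda>e. glue_map H1 H2 ` e) ` pedges H2,
      (\<lambda>l. case plabs H1 l of Some u \<Rightarrow> Some u
                           | None \<Rightarrow> map_option (glue_map H1 H2) (plabs H2 l)))"

definition unlabel_graph :: "nat set \<Rightarrow> plg \<Rightarrow> plg" where
  "unlabel_graph T H = (pverts H, pedges H, plabs H |` T)"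

definition supp :: "(plg \<Rightarrow> real) \<Rightarrow> plg set" where
  "supp f = {H. f H \<noteq> 0}"

definition RF :: "(plg \<Rightarrow> real) set" where
  "RF = {f. finite (supp f) \<and> supp f \<subseteq> Fset}"

definition RF_L :: "nat set \<Rightarrow> (plg \<Rightarrow> real) set" where
  "RF_L L = {f \<in> RF. \<forall>H \<in> supp f. dom (plabs H) = L}"

definition basis :: "plg \<Rightarrow> (plg \<Rightarrow> real)" where
  "basis H = (\<lambda>K. if K = canon H then 1 else 0)"

definition qadd :: "(plg \<Rightarrow> real) \<Rightarrow> (plg \<Rightarrow> real) \<Rightarrow> (plg \<Rightarrow> real)" where
  "qadd f g = (\<lambda>H. f H + g H)"

definition qsmult :: "real \<Rightarrow> (plg \<Rightarrow> real) \<Rightarrow> (plg \<Rightarrow> real)" where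
  "qsmult c f = (\<lambda>H. c * f H)"

definition qzero :: "plg \<Rightarrow> real" where "qzero = (\<lambda>H. 0)"

definition qmult :: "(plg \<Rightarrow> real) \<Rightarrow> (plg \<Rightarrow> real) \<Rightarrow> (plg \<Rightarrow> real)" where
  "qmult f g = (\<lambda>H. \<Sum>A\<in>supp f. \<Sum>B\<in>supp g.
                    (if canon (glue A B) = H then f A * g B else 0))"

definition qunlabel :: "nat set \<Rightarrow> (plg \<Rightarrow> real) \<Rightarrow> (plg \<Rightarrow> real)" where
  "qunlabel T f = (\<lambda>H. \<Sum>A\<in>supp f.
                    (if canon (unlabel_graph T A) = H then f A else 0))"

inductive_set Kideal :: "(plg \<Rightarrow> real) set" where
  gen: "one_vertex F \<Longrightarrow> (\<lambda>H. basis F H - basis empty_plg H) \<in> Kideal"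
| zero: "qzero \<in> Kideal"
| add: "a \<in> Kideal \<Longrightarrow> b \<in> Kideal \<Longrightarrow> qadd a b \<in> Kideal"
| smult: "a \<in> Kideal \<Longrightarrow> qsmult c a \<in> Kideal"
| mult: "g \<in> RF \<Longrightarrow> a \<in> Kideal \<Longrightarrow> qmult g a \<in> Kideal"

definition A_eq :: "(plg \<Rightarrow> real) \<Rightarrow> (plg \<Rightarrow> real) \<Rightarrow> bool" where
  "A_eq f g \<longleftrightarrow> (\<lambda>H. f H - g H) \<in> Kideal"

definition is_graph :: "nat set \<Rightarrow> nat set set \<Rightarrow> bool" where
  "is_graph VG EG \<longleftrightarrow> finite VG \<and> VG \<noteq> {} \<and> (\<forall>e\<in>EG. e \<subseteq> VG \<and> card e = 2)"

text \<open>\<open>t(H;G,\<phi>)\<close>: labeled vertices are sent according to \<open>\<phi>\<close>, unlabeled ones uniformly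
and independently at random.\<close>
definition tdens :: "plg \<Rightarrow> nat set \<Rightarrow> nat set set \<Rightarrow> (nat \<Rightarrow> nat) \<Rightarrow> real" where
  "tdens H VG EG \<phi> =
     (let U = pverts H - ran (plabs H) in
      real (card {f \<in> U \<rightarrow>\<^sub>E VG.
         \<forall>e\<in>pedges H. (\<lambda>v. if v \<in> U then f v else \<phi> (THE l. plabs H l = Some v)) ` e \<in> EG})
      / real (card VG) ^ card U)"

definition tq :: "(plg \<Rightarrow> real) \<Rightarrow> nat set \<Rightarrow> nat set set \<Rightarrow> (nat \<Rightarrow> nat) \<Rightarrow> real" where
  "tq f VG EG \<phi> = (\<Sum>H\<in>supp f. f H * tdens H VG EG \<phi>)"

definition positive_L :: "nat set \<Rightarrow> (plg \<Rightarrow> real) \<Rightarrow> bool" where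
  "positive_L L f \<longleftrightarrow> (\<forall>VG EG \<phi>. is_graph VG EG \<longrightarrow> \<phi> ` L \<subseteq> VG \<longrightarrow> tq f VG EG \<phi> \<ge> 0)"

definition sum_sq :: "(plg \<Rightarrow> real) list \<Rightarrow> (plg \<Rightarrow> real)" where
  "sum_sq gs = foldr (\<lambda>g acc. qadd (qmult g g) acc) gs qzero"

end

theory Submission
  imports Defs
begin

text \<open>
  Unlabeled quantum graphs multiply like their densities, so a nonnegative form evaluated at quantum
  graphs \<open>q\<^sub>1, q\<^sub>2, q\<^sub>3\<close> is positive. Take Robinson's form \<open>R\<close>, that is, Schur's polynomial in the squares
  of the variables. It vanishes at the points \<open>(a, b, 1)\<close> with \<open>a, b \<in> {-1, 0, 1}\<close> except that
  \<open>R(0, 0, 1) = 1\<close>.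

  Choose the \<open>q\<^sub>i\<close> so that, on a family of weighted target graphs with three free vertex weights, they
  vanish at a base point and equal the coordinates around it to first order. If
  \<open>R(q\<^sub>1, q\<^sub>2, q\<^sub>3)\<close> were a sum of squares, then on this family it would be a sum of squares of
  polynomials with weights that are positive near the base point. At distance \<open>s\<close> in the eight
  directions where \<open>R\<close> vanishes, each of these polynomials is \<open>o(s^3)\<close>. Every cubic that vanishes
  at eight points of the grid vanishes at the ninth, so each of them is \<open>o(s^3)\<close> in the direction
  \<open>(0, 0, 1)\<close> as well, whereas their weighted sum of squares is asymptotic to \<open>s^6\<close> there.
\<close>

section \<open>Densities in weighted targets\<close>

definition free_verts :: "plg \<Rightarrow> nat set" where
  "free_verts H = pverts H - ran (plabs H)"

text \<open>The vertex map tested inside \<open>tdens\<close>. Labels of a well-formed graph are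
  injective, so on a labeled vertex \<open>THE\<close> picks its only label.\<close>

definition place :: "plg \<Rightarrow> (nat \<Rightarrow> nat) \<Rightarrow> (nat \<Rightarrow> nat) \<Rightarrow> nat \<Rightarrow> nat" where
  "place H \<phi> f v = (if v \<in> free_verts H then f v else \<phi> (THE l. plabs H l = Some v))"

text \<open>When \<open>w\<close> sums to 1 over \<open>V\<close>, this is the expectation of
  \<open>F\<close> under independent \<open>w\<close>-distributed images of the elements of
  \<open>U\<close>. The weights are real numbers, so that they can later serve as the variables of
  polynomials.\<close>

definition wexp :: "nat set \<Rightarrow> (nat \<Rightarrow> real) \<Rightarrow> nat set \<Rightarrow> ((nat \<Rightarrow> nat) \<Rightarrow> real) \<Rightarrow> real" where
  "wexp V w U F = (\<Sum>f\<in>U \<rightarrow>\<^sub>E V. (\<Prod>u\<in>U. w (f u)) * F f)"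

text \<open>The target may have vertex weights and loops: a singleton in \<open>E\<close> is a loop. Loops are harmless
  because an edge of the target is still either present or absent, so that collapsing multiple edges
  preserves densities.\<close>

definition wdens :: "nat set \<Rightarrow> (nat \<Rightarrow> real) \<Rightarrow> nat set set \<Rightarrow> (nat \<Rightarrow> nat) \<Rightarrow> plg \<Rightarrow> real" where
  "wdens V w E \<phi> H =
     wexp V w (free_verts H) (\<lambda>f. of_bool (\<forall>e\<in>pedges H. place H \<phi> f ` e \<in> E))"

definition wq :: "nat set \<Rightarrow> (nat \<Rightarrow> real) \<Rightarrow> nat set set \<Rightarrow> (nat \<Rightarrow> nat) \<Rightarrow> (plg \<Rightarrow> real) \<Rightarrow> real" where
  "wq V w E \<phi> f = (\<Sum>H\<in>supp f. f H * wdens V w E \<phi> H)"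

section \<open>Finite expectations: change of variables, Fubini and marginals\<close>

lemma wexp_cong:
  assumes "\<And>f. f \<in> U \<rightarrow>\<^sub>E V \<Longrightarrow> F f = G f"
  shows "wexp V w U F = wexp V w U G"
  unfolding wexp_def using assms by (intro sum.cong) auto

text \<open>Change of variables. It serves for isomorphic copies, for the shifted copy inside a
  glued graph, and for passing from labeled vertices to their labels.\<close>

lemma wexp_reindex:
  assumes h: "bij_betw h U U'"
    and FG: "\<And>f. f \<in> U' \<rightarrow>\<^sub>E V \<Longrightarrow> F f = G (restrict (\<lambda>u. f (h u)) U)"
  shows "wexp V w U' F = wexp V w U G"
  unfolding wexp_def
proof (rule sum.reindex_bij_witness[where i = "\<lambda>g. restrict (\<lambda>v. g (inv_into U h v)) U'"
      and j = "\<lambda>f. restrict (\<lambda>u. f (h u)) U"])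
  fix f assume f: "f \<in> U' \<rightarrow>\<^sub>E V"
  have inv: "\<And>v. v \<in> U' \<Longrightarrow> inv_into U h v \<in> U" "\<And>v. v \<in> U' \<Longrightarrow> h (inv_into U h v) = v"
    using h by (auto simp: bij_betw_def inv_into_into f_inv_into_f)
  show "restrict (\<lambda>v. restrict (\<lambda>u. f (h u)) U (inv_into U h v)) U' = f"
    using f inv by (auto simp: fun_eq_iff PiE_def extensional_def)
  show "restrict (\<lambda>u. f (h u)) U \<in> U \<rightarrow>\<^sub>E V"
    using f h by (auto simp: bij_betw_def PiE_def Pi_def)
  have "(\<Prod>u\<in>U. w (f (h u))) = (\<Prod>v\<in>U'. w (f v))"
    using h by (rule prod.reindex_bij_betw)
  then show "(\<Prod>u\<in>U. w (restrict (\<lambda>u. f (h u)) U u)) * G (restrict (\<lambda>u. f (h u)) U) =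
      (\<Prod>u\<in>U'. w (f u)) * F f"
    using FG[OF f] by simp
next
  fix g assume g: "g \<in> U \<rightarrow>\<^sub>E V"
  have inv: "\<And>v. v \<in> U' \<Longrightarrow> inv_into U h v \<in> U" "\<And>u. u \<in> U \<Longrightarrow> inv_into U h (h u) = u"
    using h by (auto simp: bij_betw_def inv_into_into)
  show "restrict (\<lambda>u. restrict (\<lambda>v. g (inv_into U h v)) U' (h u)) U = g"
    using g inv h by (auto simp: fun_eq_iff PiE_def extensional_def bij_betw_def)
  show "restrict (\<lambda>v. g (inv_into U h v)) U' \<in> U' \<rightarrow>\<^sub>E V"
    using g inv by (auto simp: PiE_def Pi_def)
qed

text \<open>Fubini: a map on a disjoint union is a pair of maps, and its weight is the product of
  their weights.\<close>

lemma wexp_Un: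
  assumes fin: "finite U1" "finite U2" and disj: "U1 \<inter> U2 = {}"
  shows "wexp V w (U1 \<union> U2) F =
    wexp V w U1 (\<lambda>f. wexp V w U2 (\<lambda>g. F (\<lambda>v. if v \<in> U1 then f v else g v)))"
proof -
  have "wexp V w (U1 \<union> U2) F =
     (\<Sum>(f,g)\<in>(U1 \<rightarrow>\<^sub>E V) \<times> (U2 \<rightarrow>\<^sub>E V). (\<Prod>u\<in>U1. w (f u)) * ((\<Prod>u\<in>U2. w (g u)) *
        F (\<lambda>v. if v \<in> U1 then f v else g v)))"
    unfolding wexp_def
  proof (rule sum.reindex_bij_witness[where j = "\<lambda>f. (restrict f U1, restrict f U2)"
      and i = "\<lambda>(f,g) v. if v \<in> U1 then f v else g v"])
    fix f assume f: "f \<in> U1 \<union> U2 \<rightarrow>\<^sub>E V"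
    show eq: "(case (restrict f U1, restrict f U2) of (f, g) \<Rightarrow> \<lambda>v. if v \<in> U1 then f v else g v) = f"
      using f by (auto simp: fun_eq_iff PiE_def extensional_def)
    show "(restrict f U1, restrict f U2) \<in> (U1 \<rightarrow>\<^sub>E V) \<times> (U2 \<rightarrow>\<^sub>E V)"
      using f by auto
    show "(case (restrict f U1, restrict f U2) of (f, g) \<Rightarrow>
        (\<Prod>u\<in>U1. w (f u)) * ((\<Prod>u\<in>U2. w (g u)) * F (\<lambda>v. if v \<in> U1 then f v else g v)))
       = (\<Prod>u\<in>U1 \<union> U2. w (f u)) * F f"
      using eq by (simp add: prod.union_disjoint[OF fin disj] mult.assoc)
  next
    fix p assume "p \<in> (U1 \<rightarrow>\<^sub>E V) \<times> (U2 \<rightarrow>\<^sub>E V)"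
    then obtain f g where p: "p = (f, g)" "f \<in> U1 \<rightarrow>\<^sub>E V" "g \<in> U2 \<rightarrow>\<^sub>E V" by auto
    show "(restrict (case p of (f, g) \<Rightarrow> \<lambda>v. if v \<in> U1 then f v else g v) U1,
        restrict (case p of (f, g) \<Rightarrow> \<lambda>v. if v \<in> U1 then f v else g v) U2) = p"
      using p disj by (auto simp: fun_eq_iff PiE_def extensional_def)
    show "(case p of (f, g) \<Rightarrow> \<lambda>v. if v \<in> U1 then f v else g v) \<in> U1 \<union> U2 \<rightarrow>\<^sub>E V"
      using p by (auto simp: PiE_def extensional_def Pi_def)
  qed
  then show ?thesis
    by (simp add: wexp_def sum.cartesian_product sum_distrib_left)
qed

lemma wexp_mult_right: "wexp V w U (\<lambda>f. F f * c) = wexp V w U F * c"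
  by (simp add: wexp_def sum_distrib_right mult.assoc)

lemma wexp_mult_left: "wexp V w U (\<lambda>f. c * F f) = c * wexp V w U F"
  by (simp add: wexp_def sum_distrib_left mult_ac)

lemma wexp_sum: "wexp V w U (\<lambda>f. \<Sum>i\<in>I. F i f) = (\<Sum>i\<in>I. wexp V w U (F i))"
  unfolding wexp_def sum_distrib_left by (rule sum.swap)

lemma wexp_const:
  assumes "finite V" "sum w V = 1" "finite U"
  shows "wexp V w U (\<lambda>_. c) = c"
proof -
  have "(\<Sum>f\<in>U \<rightarrow>\<^sub>E V. \<Prod>u\<in>U. w (f u)) = (\<Prod>u\<in>U. sum w V)"
    using assms(1,3) prod_sum_PiE[of U "\<lambda>_. V" "\<lambda>_. w"] by simp
  also have "\<dots> = 1" using assms(2) by simp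
  finally show ?thesis
    using assms by (simp add: wexp_def flip: sum_distrib_right)
qed

text \<open>The coordinates outside \<open>D\<close> integrate to the total mass 1. This allows
  labels to be averaged over one common set even when a particular graph carries only some of
  them.\<close>

lemma wexp_restrict:
  assumes "finite V" "sum w V = 1" "finite U" "D \<subseteq> U"
    and F: "\<And>f g. (\<And>u. u \<in> D \<Longrightarrow> f u = g u) \<Longrightarrow> F f = F g"
  shows "wexp V w U F = wexp V w D F"
proof -
  have fin: "finite D" "finite (U - D)" using assms by (auto intro: finite_subset)
  have U: "D \<union> (U - D) = U" using assms by auto
  have "wexp V w U F = wexp V w D (\<lambda>f. wexp V w (U - D) (\<lambda>g. F (\<lambda>v. if v \<in> D then f v else g v)))"
    using wexp_Un[OF fin, of V w F] unfolding U by blast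
  also have "\<dots> = wexp V w D (\<lambda>f. wexp V w (U - D) (\<lambda>g. F f))"
    by (rule wexp_cong, rule wexp_cong, rule F) simp
  finally show ?thesis using assms(1,2) fin by (simp add: wexp_const)
qed

section \<open>Placement of vertices and invariance under isomorphism\<close>

lemma wf_label_THE:
  assumes "wf_plg H" "plabs H l = Some v"
  shows "(THE l. plabs H l = Some v) = l"
  using assms by (intro the_equality) (auto simp: wf_plg_def inj_on_def dom_def)

lemma place_free: "v \<in> free_verts H \<Longrightarrow> place H \<phi> f v = f v"
  by (simp add: place_def)

lemma place_label:
  assumes "wf_plg H" "plabs H l = Some v"
  shows "place H \<phi> f v = \<phi> l"
  using wf_label_THE[OF assms] assms by (auto simp: place_def free_verts_def ran_def)

lemma pverts_cases:
  assumes "v \<in> pverts H"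
  obtains (free) "v \<in> free_verts H" | (label) l where "plabs H l = Some v"
  using assms by (auto simp: free_verts_def ran_def)

lemma finite_free_verts: "wf_plg H \<Longrightarrow> finite (free_verts H)"
  by (auto simp: wf_plg_def free_verts_def)

lemma wf_edge_vert: "wf_plg H \<Longrightarrow> e \<in> pedges H \<Longrightarrow> v \<in> e \<Longrightarrow> v \<in> pverts H"
  by (auto simp: wf_plg_def)

text \<open>An isomorphism restricts to a bijection of the free vertices and matches labeled
  vertices with equal labels, so homomorphisms correspond with equal weights.\<close>

lemma wdens_iso:
  assumes wf: "wf_plg H" "wf_plg K" and iso: "plg_iso H K"
  shows "wdens V w E \<phi> K = wdens V w E \<phi> H"
proof -
  obtain p where p: "bij_betw p (pverts H) (pverts K)"
    and pe: "pedges K = (\<lambda>e. p ` e) ` pedges H"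
    and pl: "plabs K = (\<lambda>l. map_option p (plabs H l))"
    using iso by (auto simp: plg_iso_def)
  have ranK: "ran (plabs K) = p ` ran (plabs H)"
    unfolding pl ran_def by auto
  have "ran (plabs H) \<subseteq> pverts H" using wf by (simp add: wf_plg_def)
  then have bij: "bij_betw p (free_verts H) (free_verts K)"
    using p unfolding free_verts_def ranK bij_betw_def
    by (simp add: inj_on_image_set_diff[of p "pverts H"] inj_on_diff)
  show ?thesis unfolding wdens_def
  proof (rule wexp_reindex[OF bij])
    fix f assume "f \<in> free_verts K \<rightarrow>\<^sub>E V"
    have place_eq: "place K \<phi> f (p v) = place H \<phi> (restrict (\<lambda>u. f (p u)) (free_verts H)) v"
      if v: "v \<in> pverts H" for v
      using v
    proof (cases rule: pverts_cases)
      case free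
      with bij have "p v \<in> free_verts K" by (auto simp: bij_betw_def)
      with free show ?thesis by (simp add: place_free)
    next
      case (label l)
      then have "plabs K l = Some (p v)" by (simp add: pl)
      with label wf show ?thesis by (simp add: place_label)
    qed
    have "place K \<phi> f ` (p ` e) = place H \<phi> (restrict (\<lambda>u. f (p u)) (free_verts H)) ` e"
      if "e \<in> pedges H" for e
      unfolding image_image using that place_eq
      by (intro image_cong) (auto dest: wf_edge_vert[OF wf(1)])
    then show "(of_bool (\<forall>e\<in>pedges K. place K \<phi> f ` e \<in> E) :: real) =
      of_bool (\<forall>e\<in>pedges H. place H \<phi> (restrict (\<lambda>u. f (p u)) (free_verts H)) ` e \<in> E)"
      by (simp add: pe)
  qed
qed

lemma plg_iso_canon: "plg_iso H (canon H)"
proof -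
  have "plg_iso H H" unfolding plg_iso_def
    by (rule exI[of _ id]) (auto simp: option.map_id0 id_def[symmetric])
  then show ?thesis unfolding canon_def by (metis mem_Collect_eq someI_ex)
qed

lemma wf_plg_iso:
  assumes "wf_plg H" "plg_iso H K"
  shows "wf_plg K"
proof -
  obtain p where p: "bij_betw p (pverts H) (pverts K)"
    and pe: "pedges K = (\<lambda>e. p ` e) ` pedges H"
    and pl: "plabs K = (\<lambda>l. map_option p (plabs H l))"
    using assms by (auto simp: plg_iso_def)
  have dom: "dom (plabs K) = dom (plabs H)" by (auto simp: pl dom_def)
  have sub: "ran (plabs H) \<subseteq> pverts H" and inj: "inj_on (plabs H) (dom (plabs H))"
    using assms by (auto simp: wf_plg_def)
  have "finite (pverts K)" using p assms by (auto simp: wf_plg_def bij_betw_finite)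
  moreover have "e \<subseteq> pverts K \<and> card e = 2" if e: "e \<in> pedges K" for e
  proof -
    obtain e' where e': "e' \<in> pedges H" "e = p ` e'" using e by (auto simp: pe)
    then have "e' \<subseteq> pverts H" "card e' = 2" using assms by (auto simp: wf_plg_def)
    moreover have "inj_on p e'" using p \<open>e' \<subseteq> pverts H\<close> by (auto simp: bij_betw_def inj_on_subset)
    ultimately show ?thesis using p e' by (auto simp: card_image bij_betw_def)
  qed
  moreover have "ran (plabs K) \<subseteq> pverts K"
    using sub p by (auto simp: pl ran_def bij_betw_def)
  moreover have "inj_on (plabs K) (dom (plabs K))"
  proof (rule inj_onI)
    fix k l assume kl: "k \<in> dom (plabs K)" "l \<in> dom (plabs K)" "plabs K k = plabs K l"
    then obtain u v where uv: "plabs H k = Some u" "plabs H l = Some v" by (auto simp: pl)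
    then have "u \<in> pverts H" "v \<in> pverts H" using sub by (auto simp: ran_def)
    moreover have "p u = p v" using kl uv by (simp add: pl)
    ultimately have "u = v" using p by (auto simp: bij_betw_def inj_on_def)
    then show "k = l" using inj uv by (auto simp: inj_on_def dom_def)
  qed
  ultimately show ?thesis using assms dom by (auto simp: wf_plg_def)
qed

lemma wf_canon: "wf_plg H \<Longrightarrow> wf_plg (canon H)"
  using plg_iso_canon wf_plg_iso by blast

lemma wf_Fset: "H \<in> Fset \<Longrightarrow> wf_plg H"
  by (auto simp: Fset_def wf_canon)

lemma canon_Fset: "wf_plg H \<Longrightarrow> canon H \<in> Fset"
  by (auto simp: Fset_def)

lemma dom_plabs_canon: "dom (plabs (canon H)) = dom (plabs H)"
  using plg_iso_canon[of H] by (auto simp: plg_iso_def dom_def)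

lemma wdens_canon: "wf_plg H \<Longrightarrow> wdens V w E \<phi> (canon H) = wdens V w E \<phi> H"
  by (intro wdens_iso wf_canon plg_iso_canon)

section \<open>Gluing and unlabeling\<close>

text \<open>The second branch of \<open>glue_map\<close> under its own name: vertices of the second
  factor that share no label with \<open>A\<close> are moved past the largest vertex of
  \<open>A\<close>.\<close>

definition glue_shift :: "plg \<Rightarrow> nat \<Rightarrow> nat" where
  "glue_shift A v = Suc (Max (insert 0 (pverts A))) + v"

lemma glue_shift_notin: "finite (pverts A) \<Longrightarrow> glue_shift A v \<notin> pverts A"
proof
  assume "finite (pverts A)" "glue_shift A v \<in> pverts A"
  then have "glue_shift A v \<le> Max (insert 0 (pverts A))" by (intro Max_ge) auto
  then show False unfolding glue_shift_def by linarith
qed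

lemma glue_shift_inject: "glue_shift A u = glue_shift A v \<longleftrightarrow> u = v"
  by (simp add: glue_shift_def)

lemma glue_map_shared:
  assumes "wf_plg B" "plabs B l = Some v" "plabs A l = Some u"
  shows "glue_map A B v = u"
  using assms wf_label_THE[OF assms(1,2)] by (auto simp: glue_map_def)

lemma glue_map_label:
  assumes "wf_plg B" "plabs B l = Some v" "plabs A l = None"
  shows "glue_map A B v = glue_shift A v"
proof -
  have "\<not> (\<exists>l. plabs B l = Some v \<and> plabs A l \<noteq> None)"
    using assms wf_label_THE[OF assms(1)] by (metis)
  then show ?thesis unfolding glue_map_def glue_shift_def by (rule if_not_P)
qed

lemma glue_map_free:
  assumes "v \<in> free_verts B"
  shows "glue_map A B v = glue_shift A v"
proof -
  have "\<not> (\<exists>l. plabs B l = Some v \<and> plabs A l \<noteq> None)"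
    using assms by (auto simp: free_verts_def ran_def)
  then show ?thesis unfolding glue_map_def glue_shift_def by (rule if_not_P)
qed

lemma pverts_glue: "pverts (glue A B) = pverts A \<union> glue_map A B ` pverts B"
  and pedges_glue: "pedges (glue A B) = pedges A \<union> (\<lambda>e. glue_map A B ` e) ` pedges B"
  by (simp_all add: pverts_def pedges_def glue_def)

lemma plabs_glue: "plabs (glue A B) l =
    (case plabs A l of Some u \<Rightarrow> Some u | None \<Rightarrow> map_option (glue_map A B) (plabs B l))"
  by (simp add: plabs_def glue_def)

lemma dom_plabs_glue: "dom (plabs (glue A B)) = dom (plabs A) \<union> dom (plabs B)"
  by (auto simp: dom_def plabs_glue split: option.splits)

lemma label_vert: "wf_plg H \<Longrightarrow> plabs H l = Some v \<Longrightarrow> v \<in> pverts H"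
  by (auto simp: wf_plg_def ran_def)

lemma label_inj: "wf_plg H \<Longrightarrow> plabs H k = Some v \<Longrightarrow> plabs H l = Some v \<Longrightarrow> k = l"
  by (metis wf_label_THE)

lemma plabs_glue_left: "plabs A l = Some u \<Longrightarrow> plabs (glue A B) l = Some u"
  by (simp add: plabs_glue)

lemma plabs_glue_right:
  assumes "wf_plg B" "plabs B l = Some v"
  shows "plabs (glue A B) l = Some (glue_map A B v)"
  using assms glue_map_shared[OF assms] by (auto simp: plabs_glue split: option.splits)

lemma plabs_glueE:
  assumes "plabs (glue A B) l = Some v"
  obtains (left) "plabs A l = Some v"
  | (right) u where "plabs A l = None" "plabs B l = Some u" "v = glue_map A B u"
  using assms by (auto simp: plabs_glue split: option.splits)

text \<open>A shared vertex lands in \<open>A\<close>, any other vertex beyond \<open>A\<close>. Two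
  shared vertices with the same image carry the same label, hence coincide. Injectivity keeps edges
  two-element after gluing.\<close>

lemma inj_glue_map:
  assumes wf: "wf_plg A" "wf_plg B"
  shows "inj_on (glue_map A B) (pverts B)"
proof (rule inj_onI)
  have char: "(\<exists>l a. plabs B l = Some u \<and> plabs A l = Some a \<and> glue_map A B u = a) \<or>
      glue_map A B u = glue_shift A u" if "u \<in> pverts B" for u
    using that
  proof (cases rule: pverts_cases)
    case free then show ?thesis by (simp add: glue_map_free)
  next
    case (label l)
    then show ?thesis
      using glue_map_shared[OF wf(2) label] glue_map_label[OF wf(2) label]
      by (cases "plabs A l") auto
  qed
  have fin: "finite (pverts A)" using wf by (simp add: wf_plg_def)
  fix u v assume uv: "u \<in> pverts B" "v \<in> pverts B" "glue_map A B u = glue_map A B v"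
  show "u = v"
    using char[OF uv(1)] char[OF uv(2)] uv(3)
    by (metis fin glue_shift_inject glue_shift_notin label_inj label_vert option.inject wf(1))
qed

lemma wf_glue:
  assumes wf: "wf_plg A" "wf_plg B"
  shows "wf_plg (glue A B)"
proof -
  have fin: "finite (pverts A)" using wf by (simp add: wf_plg_def)
  have "e \<subseteq> pverts (glue A B) \<and> card e = 2" if e: "e \<in> pedges (glue A B)" for e
  proof (cases "e \<in> pedges A")
    case True
    then show ?thesis using wf by (auto simp: wf_plg_def pverts_glue)
  next
    case False
    then obtain e' where e': "e' \<in> pedges B" "e = glue_map A B ` e'"
      using e by (auto simp: pedges_glue)
    then have "e' \<subseteq> pverts B" "card e' = 2" using wf by (auto simp: wf_plg_def)
    then show ?thesis
      using e' inj_on_subset[OF inj_glue_map[OF wf]] by (auto simp: pverts_glue card_image)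
  qed
  moreover have "ran (plabs (glue A B)) \<subseteq> pverts (glue A B)"
  proof
    fix v assume "v \<in> ran (plabs (glue A B))"
    then obtain l where "plabs (glue A B) l = Some v" by (auto simp: ran_def)
    then show "v \<in> pverts (glue A B)"
      by (cases rule: plabs_glueE) (auto simp: pverts_glue label_vert[OF wf(1)] label_vert[OF wf(2)])
  qed
  moreover have "inj_on (plabs (glue A B)) (dom (plabs (glue A B)))"
  proof (rule inj_onI)
    fix k l assume "k \<in> dom (plabs (glue A B))" "l \<in> dom (plabs (glue A B))"
      "plabs (glue A B) k = plabs (glue A B) l"
    then obtain v where k: "plabs (glue A B) k = Some v" and l: "plabs (glue A B) l = Some v"
      by auto
    show "k = l" using k
    proof (cases rule: plabs_glueE)
      case left
      note kl = left
      show ?thesis using l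
      proof (cases rule: plabs_glueE)
        case left
        then show ?thesis using kl label_inj[OF wf(1)] by auto
      next
        case (right u)
        then show ?thesis
          using kl glue_map_label[OF wf(2)] label_vert[OF wf(1)] glue_shift_notin[OF fin] by metis
      qed
    next
      case (right u)
      note kr = right
      show ?thesis using l
      proof (cases rule: plabs_glueE)
        case left
        then show ?thesis
          using kr glue_map_label[OF wf(2)] label_vert[OF wf(1)] glue_shift_notin[OF fin] by metis
      next
        case (right u')
        then show ?thesis
          using kr glue_map_label[OF wf(2)] glue_shift_inject label_inj[OF wf(2)] by metis
      qed
    qed
  qed
  moreover have "finite (pverts (glue A B))"
    using wf by (simp add: pverts_glue wf_plg_def)
  moreover have "finite (dom (plabs (glue A B)))" "dom (plabs (glue A B)) \<subseteq> {1..}"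
    using wf by (auto simp: dom_plabs_glue wf_plg_def)
  ultimately show ?thesis by (simp add: wf_plg_def)
qed

lemma free_verts_glue:
  assumes wf: "wf_plg A" "wf_plg B"
  shows "free_verts (glue A B) = free_verts A \<union> glue_shift A ` free_verts B"
proof (intro equalityI subsetI)
  fix v assume v: "v \<in> free_verts (glue A B)"
  then have nolab: "\<And>l. plabs (glue A B) l \<noteq> Some v" by (auto simp: free_verts_def ran_def)
  show "v \<in> free_verts A \<union> glue_shift A ` free_verts B"
  proof (cases "v \<in> pverts A")
    case True
    moreover have "plabs A l \<noteq> Some v" for l using nolab plabs_glue_left by metis
    ultimately show ?thesis by (auto simp: free_verts_def ran_def)
  next
    case False
    then obtain u where u: "u \<in> pverts B" "v = glue_map A B u"
      using v by (auto simp: free_verts_def pverts_glue)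
    have "u \<in> free_verts B"
      using u nolab plabs_glue_right[OF wf(2), of _ u A] by (auto simp: free_verts_def ran_def)
    then show ?thesis using u by (simp add: glue_map_free)
  qed
next
  have fin: "finite (pverts A)" using wf by (simp add: wf_plg_def)
  fix v assume "v \<in> free_verts A \<union> glue_shift A ` free_verts B"
  then consider "v \<in> free_verts A" | u where "u \<in> free_verts B" "v = glue_shift A u" by auto
  then show "v \<in> free_verts (glue A B)"
  proof cases
    case 1
    then have "plabs (glue A B) l \<noteq> Some v" for l
      using glue_map_label[OF wf(2)] glue_shift_notin[OF fin]
      by (metis DiffE free_verts_def plabs_glueE ranI)
    then show ?thesis using 1 by (auto simp: free_verts_def pverts_glue ran_def)
  next
    case 2
    then have "plabs (glue A B) l \<noteq> Some v" for l
      using glue_map_label[OF wf(2)] glue_shift_notin[OF fin] glue_shift_inject label_vert[OF wf(1)]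
      by (metis DiffE free_verts_def plabs_glueE ranI)
    moreover have "v \<in> pverts (glue A B)"
      using 2 glue_map_free[OF 2(1), of A] by (auto simp: free_verts_def pverts_glue intro!: image_eqI)
    ultimately show ?thesis by (auto simp: free_verts_def ran_def)
  qed
qed

text \<open>Once \<phi> is fixed, the two factors use disjoint sets of free vertices, so their
  homomorphism events are independent. An edge coming from both factors imposes the same condition
  whether it is counted once or twice.\<close>

lemma wdens_glue:
  assumes wf: "wf_plg A" "wf_plg B"
  shows "wdens V w E \<phi> (glue A B) = wdens V w E \<phi> A * wdens V w E \<phi> B"
proof -
  have fin: "finite (pverts A)" using wf by (simp add: wf_plg_def)
  note wfg = wf_glue[OF wf]
  let ?s = "glue_shift A" and ?UA = "free_verts A" and ?UB = "free_verts B"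
  have disj: "?UA \<inter> ?s ` ?UB = {}"
    using glue_shift_notin[OF fin] by (auto simp: free_verts_def)
  have U: "free_verts (glue A B) = ?UA \<union> ?s ` ?UB" by (rule free_verts_glue[OF wf])
  let ?m = "\<lambda>f g v. if v \<in> ?UA then f v else g v :: nat"
  let ?r = "\<lambda>g. restrict (\<lambda>u. g (?s u)) ?UB"
  have placeA: "place (glue A B) \<phi> (?m f g) v = place A \<phi> f v" if "v \<in> pverts A" for f g v
    using that
  proof (cases rule: pverts_cases)
    case free
    then show ?thesis using U by (simp add: place_free)
  next
    case (label l)
    then show ?thesis
      by (simp add: place_label[OF wf(1)] place_label[OF wfg plabs_glue_left])
  qed
  have placeB: "place (glue A B) \<phi> (?m f g) (glue_map A B v) = place B \<phi> (?r g) v"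
    if "v \<in> pverts B" for f g v
    using that
  proof (cases rule: pverts_cases)
    case free
    then have "?s v \<in> free_verts (glue A B)" "?s v \<notin> ?UA" using U disj by auto
    then show ?thesis using free by (simp add: place_free glue_map_free)
  next
    case (label l)
    then show ?thesis
      by (simp add: place_label[OF wf(2)] place_label[OF wfg plabs_glue_right[OF wf(2)]])
  qed
  have hom: "(\<forall>e\<in>pedges (glue A B). place (glue A B) \<phi> (?m f g) ` e \<in> E) \<longleftrightarrow>
     (\<forall>e\<in>pedges A. place A \<phi> f ` e \<in> E) \<and> (\<forall>e\<in>pedges B. place B \<phi> (?r g) ` e \<in> E)" for f g
  proof -
    have "place (glue A B) \<phi> (?m f g) ` e = place A \<phi> f ` e" if "e \<in> pedges A" for e
      using that wf placeA by (intro image_cong) (auto dest: wf_edge_vert)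
    moreover have "place (glue A B) \<phi> (?m f g) ` glue_map A B ` e = place B \<phi> (?r g) ` e"
      if "e \<in> pedges B" for e
      unfolding image_image using that wf placeB by (intro image_cong) (auto dest: wf_edge_vert)
    ultimately show ?thesis by (simp add: pedges_glue ball_Un)
  qed
  have "wdens V w E \<phi> (glue A B) = wexp V w ?UA (\<lambda>f. wexp V w (?s ` ?UB) (\<lambda>g.
      of_bool (\<forall>e\<in>pedges A. place A \<phi> f ` e \<in> E) * of_bool (\<forall>e\<in>pedges B. place B \<phi> (?r g) ` e \<in> E)))"
    unfolding wdens_def U using wf disj
    by (subst wexp_Un) (auto simp: finite_free_verts hom of_bool_conj simp del: if_split_asm)
  also have "\<dots> = wdens V w E \<phi> A *
      wexp V w (?s ` ?UB) (\<lambda>g. of_bool (\<forall>e\<in>pedges B. place B \<phi> (?r g) ` e \<in> E))"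
    by (simp add: wexp_mult_left wexp_mult_right wdens_def)
  also have "wexp V w (?s ` ?UB) (\<lambda>g. of_bool (\<forall>e\<in>pedges B. place B \<phi> (?r g) ` e \<in> E)) = wdens V w E \<phi> B"
    unfolding wdens_def
    by (rule wexp_reindex[where h = ?s]) (auto simp: bij_betw_def inj_on_def glue_shift_inject)
  finally show ?thesis .
qed

section \<open>Unlabeling as averaging, and the case of uniform weights\<close>

lemma wf_unlabel_graph:
  assumes "wf_plg H"
  shows "wf_plg (unlabel_graph T H)"
proof -
  have "ran (plabs H |` T) \<subseteq> ran (plabs H)"
    by (auto simp: ran_def restrict_map_def)
  moreover have "inj_on (plabs H |` T) (dom (plabs H) \<inter> T)"
    using assms by (simp add: wf_plg_def inj_on_def)
  moreover have "pverts (unlabel_graph T H) = pverts H" "pedges (unlabel_graph T H) = pedges H"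
    "plabs (unlabel_graph T H) = plabs H |` T"
    by (simp_all add: unlabel_graph_def pverts_def pedges_def plabs_def)
  ultimately show ?thesis
    using assms unfolding wf_plg_def by (simp add: dom_restrict) blast
qed

lemma wdens_cong_labels:
  assumes wf: "wf_plg H" and \<phi>: "\<And>l. l \<in> dom (plabs H) \<Longrightarrow> \<phi> l = \<psi> l"
  shows "wdens V w E \<phi> H = wdens V w E \<psi> H"
proof -
  have "place H \<phi> f v = place H \<psi> f v" if "v \<in> pverts H" for f v
    using that by (cases rule: pverts_cases) (auto simp: place_free place_label[OF wf] \<phi> dom_def)
  then have "place H \<phi> f ` e = place H \<psi> f ` e" if "e \<in> pedges H" for f e
    using that by (intro image_cong) (auto dest: wf_edge_vert[OF wf])
  then show ?thesis unfolding wdens_def by (intro wexp_cong) auto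
qed

text \<open>A vertex that loses its label is placed at random, exactly as a random \<phi> would
  place that label. Labels of \<open>L\<close> absent from \<open>H\<close> integrate out.\<close>

lemma wdens_unlabel:
  assumes V: "finite V" "sum w V = 1" and wf: "wf_plg H"
    and L: "finite L" "dom (plabs H) \<subseteq> L"
  shows "wdens V w E \<theta> (unlabel_graph {} H) = wexp V w L (\<lambda>\<phi>. wdens V w E \<phi> H)"
proof -
  let ?D = "dom (plabs H)" and ?R = "ran (plabs H)" and ?U = "free_verts H"
  let ?m = "\<lambda>f g v. if v \<in> ?R then f v else g v :: nat"
  let ?r = "\<lambda>f. restrict (\<lambda>l. f (the (plabs H l))) ?D"
  have RU: "pverts H = ?R \<union> ?U" and disj: "?R \<inter> ?U = {}"
    using wf by (auto simp: wf_plg_def free_verts_def)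
  have fin: "finite ?R" "finite ?U"
    using wf by (auto simp: finite_free_verts wf_plg_def intro: finite_subset)
  have bij: "bij_betw (\<lambda>l. the (plabs H l)) ?D ?R"
    unfolding bij_betw_def using label_inj[OF wf] by (auto simp: inj_on_def ran_def image_iff) force
  have free: "free_verts (unlabel_graph {} H) = pverts H"
    and edges: "pedges (unlabel_graph {} H) = pedges H"
    by (simp_all add: unlabel_graph_def free_verts_def pverts_def plabs_def pedges_def)
  have place_eq: "place (unlabel_graph {} H) \<theta> (?m f g) v = place H (?r f) g v"
    if v: "v \<in> pverts H" for f g v
    using v
  proof (cases rule: pverts_cases)
    case free': free
    then show ?thesis using disj v by (auto simp: place_free free)
  next
    case (label l)
    then have "v \<in> ?R" by (auto simp: ran_def)
    then show ?thesis using v label by (simp add: place_label[OF wf label] place_free free dom_def)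
  qed
  have hom: "place (unlabel_graph {} H) \<theta> (?m f g) ` e = place H (?r f) g ` e" if "e \<in> pedges H" for f g e
    using that place_eq by (intro image_cong) (auto dest: wf_edge_vert[OF wf])
  have "wdens V w E \<theta> (unlabel_graph {} H) = wexp V w ?R (\<lambda>f. wdens V w E (?r f) H)"
    unfolding wdens_def free edges RU
    by (subst wexp_Un[OF fin disj]) (intro wexp_cong arg_cong[of _ _ of_bool] ball_cong refl, simp only: hom)
  also have "\<dots> = wexp V w ?D (\<lambda>\<phi>. wdens V w E \<phi> H)"
    by (rule wexp_reindex[OF bij]) simp
  also have "\<dots> = wexp V w L (\<lambda>\<phi>. wdens V w E \<phi> H)"
    by (rule wexp_restrict[symmetric, OF V L]) (rule wdens_cong_labels[OF wf])
  finally show ?thesis .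
qed

lemma tdens_eq_wdens:
  assumes V: "finite V" and wf: "wf_plg H"
  shows "tdens H V E \<phi> = wdens V (\<lambda>_. 1 / real (card V)) E \<phi> H"
proof -
  let ?U = "free_verts H"
  have fin: "finite (?U \<rightarrow>\<^sub>E V)" using V finite_free_verts[OF wf] by (simp add: finite_PiE)
  have "tdens H V E \<phi> =
    real (card {f \<in> ?U \<rightarrow>\<^sub>E V. \<forall>e\<in>pedges H. place H \<phi> f ` e \<in> E}) / real (card V) ^ card ?U"
    unfolding tdens_def Let_def place_def[abs_def] free_verts_def ..
  also have "real (card {f \<in> ?U \<rightarrow>\<^sub>E V. \<forall>e\<in>pedges H. place H \<phi> f ` e \<in> E}) =
     (\<Sum>f\<in>?U \<rightarrow>\<^sub>E V. of_bool (\<forall>e\<in>pedges H. place H \<phi> f ` e \<in> E))"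
    using fin by (simp add: sum_of_bool_eq Int_def)
  also have "\<dots> / real (card V) ^ card ?U = wdens V (\<lambda>_. 1 / real (card V)) E \<phi> H"
    by (simp add: wdens_def wexp_def sum_divide_distrib power_one_over flip: divide_inverse)
  finally show ?thesis .
qed

section \<open>Evaluating quantum graphs\<close>

lemma wq_superset:
  assumes "finite S" "supp f \<subseteq> S"
  shows "wq V w E \<phi> f = (\<Sum>H\<in>S. f H * wdens V w E \<phi> H)"
  unfolding wq_def using assms by (intro sum.mono_neutral_left) (auto simp: supp_def)

text \<open>Both \<open>qmult\<close> and \<open>qunlabel\<close> push coefficients forward along a
  map \<open>k\<close> to isomorphism classes, adding those that meet in one class. Their evaluation
  is treated here once for both.\<close>

lemma wq_collect:
  assumes I: "finite I" and x: "x = (\<lambda>H. \<Sum>i\<in>I. if k i = H then c i else 0)"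
  shows "supp x \<subseteq> k ` I" and "wq V w E \<phi> x = (\<Sum>i\<in>I. c i * wdens V w E \<phi> (k i))"
proof -
  show sub: "supp x \<subseteq> k ` I"
  proof
    fix H assume "H \<in> supp x"
    then have "(\<Sum>i\<in>I. if k i = H then c i else 0) \<noteq> 0"
      by (simp add: supp_def x)
    then obtain i where "i \<in> I" "(if k i = H then c i else 0) \<noteq> 0"
      by (rule sum.not_neutral_contains_not_neutral)
    then show "H \<in> k ` I" by (auto split: if_splits)
  qed
  have "wq V w E \<phi> x = (\<Sum>H\<in>k ` I. x H * wdens V w E \<phi> H)"
    using I sub by (intro wq_superset) auto
  also have "\<dots> = (\<Sum>H\<in>k ` I. \<Sum>i\<in>I. if k i = H then c i * wdens V w E \<phi> H else 0)"
    unfolding x sum_distrib_right by (intro sum.cong refl) simp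
  also have "\<dots> = (\<Sum>i\<in>I. c i * wdens V w E \<phi> (k i))"
    using I by (subst sum.swap) (auto intro!: sum.cong)
  finally show "wq V w E \<phi> x = (\<Sum>i\<in>I. c i * wdens V w E \<phi> (k i))" .
qed

lemma RF_finite: "f \<in> RF \<Longrightarrow> finite (supp f)"
  and RF_wf: "f \<in> RF \<Longrightarrow> H \<in> supp f \<Longrightarrow> wf_plg H"
  by (auto simp: RF_def wf_Fset)

lemma RF_I: "finite S \<Longrightarrow> S \<subseteq> Fset \<Longrightarrow> supp f \<subseteq> S \<Longrightarrow> f \<in> RF"
  by (auto simp: RF_def intro: finite_subset)

lemma qmult_collect:
  "qmult f g = (\<lambda>H. \<Sum>p\<in>supp f \<times> supp g.
     if canon (glue (fst p) (snd p)) = H then f (fst p) * g (snd p) else 0)"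
  by (simp add: qmult_def sum.cartesian_product case_prod_unfold)

lemma supp_qmult:
  assumes "f \<in> RF" "g \<in> RF"
  shows "supp (qmult f g) \<subseteq> (\<lambda>p. canon (glue (fst p) (snd p))) ` (supp f \<times> supp g)"
  by (rule wq_collect(1)[OF _ qmult_collect]) (use assms RF_finite in auto)

lemma RF_qmult: "f \<in> RF \<Longrightarrow> g \<in> RF \<Longrightarrow> qmult f g \<in> RF"
  by (rule RF_I[OF _ _ supp_qmult]) (auto simp: RF_finite RF_wf wf_glue canon_Fset)

lemma wq_qmult:
  assumes fg: "f \<in> RF" "g \<in> RF"
  shows "wq V w E \<phi> (qmult f g) = wq V w E \<phi> f * wq V w E \<phi> g"
proof -
  have "wq V w E \<phi> (qmult f g) = (\<Sum>p\<in>supp f \<times> supp g.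
      f (fst p) * g (snd p) * wdens V w E \<phi> (canon (glue (fst p) (snd p))))"
    by (rule wq_collect(2)[OF _ qmult_collect]) (use assms RF_finite in auto)
  also have "\<dots> = (\<Sum>p\<in>supp f \<times> supp g.
      (f (fst p) * wdens V w E \<phi> (fst p)) * (g (snd p) * wdens V w E \<phi> (snd p)))"
    using RF_wf fg by (intro sum.cong) (auto simp: wdens_canon wf_glue wdens_glue)
  finally show ?thesis
    by (simp add: wq_def sum_product sum.cartesian_product case_prod_unfold)
qed

lemma qunlabel_collect:
  "qunlabel T f = (\<lambda>H. \<Sum>A\<in>supp f. if canon (unlabel_graph T A) = H then f A else 0)"
  by (simp add: qunlabel_def)

lemma RF_qunlabel:
  assumes "f \<in> RF"
  shows "qunlabel T f \<in> RF"
proof (rule RF_I)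
  show "supp (qunlabel T f) \<subseteq> (\<lambda>A. canon (unlabel_graph T A)) ` supp f"
    by (rule wq_collect(1)[OF _ qunlabel_collect]) (use assms RF_finite in auto)
qed (use assms in \<open>auto simp: RF_finite RF_wf wf_unlabel_graph canon_Fset\<close>)

lemma wq_qunlabel:
  assumes V: "finite V" "sum w V = 1" and f: "f \<in> RF"
    and L: "finite L" "\<And>H. H \<in> supp f \<Longrightarrow> dom (plabs H) \<subseteq> L"
  shows "wq V w E \<theta> (qunlabel {} f) = wexp V w L (\<lambda>\<phi>. wq V w E \<phi> f)"
proof -
  have "wq V w E \<theta> (qunlabel {} f) =
      (\<Sum>A\<in>supp f. f A * wdens V w E \<theta> (canon (unlabel_graph {} A)))"
    by (rule wq_collect(2)[OF _ qunlabel_collect]) (use f RF_finite in auto)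
  also have "\<dots> = (\<Sum>A\<in>supp f. f A * wexp V w L (\<lambda>\<phi>. wdens V w E \<phi> A))"
    using RF_wf[OF f] L
    by (intro sum.cong refl) (simp add: wdens_canon wf_unlabel_graph wdens_unlabel[OF V _ L(1)])
  finally show ?thesis by (simp add: wq_def wexp_sum wexp_mult_left)
qed

section \<open>Linearity of evaluation and its descent to the quotient\<close>

lemma supp_qadd: "supp (qadd f g) \<subseteq> supp f \<union> supp g"
  by (auto simp: supp_def qadd_def)

lemma RF_qadd: "f \<in> RF \<Longrightarrow> g \<in> RF \<Longrightarrow> qadd f g \<in> RF"
  by (rule RF_I[OF _ _ supp_qadd]) (auto simp: RF_def)

lemma wq_qadd:
  assumes "f \<in> RF" "g \<in> RF"
  shows "wq V w E \<phi> (qadd f g) = wq V w E \<phi> f + wq V w E \<phi> g"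
proof -
  have fin: "finite (supp f \<union> supp g)" using assms by (simp add: RF_finite)
  show ?thesis
    using wq_superset[OF fin supp_qadd] wq_superset[OF fin, of f] wq_superset[OF fin, of g]
    by (simp add: qadd_def distrib_right sum.distrib)
qed

lemma supp_qsmult: "supp (qsmult c f) \<subseteq> supp f"
  by (auto simp: supp_def qsmult_def)

lemma RF_qsmult: "f \<in> RF \<Longrightarrow> qsmult c f \<in> RF"
  by (rule RF_I[OF _ _ supp_qsmult]) (auto simp: RF_def)

lemma wq_qsmult:
  assumes "f \<in> RF"
  shows "wq V w E \<phi> (qsmult c f) = c * wq V w E \<phi> f"
  using wq_superset[OF RF_finite[OF assms] supp_qsmult]
  by (simp add: qsmult_def wq_def sum_distrib_left mult.assoc)

lemma supp_basis: "supp (basis H) = {canon H}"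
  by (auto simp: supp_def basis_def)

lemma RF_basis: "wf_plg H \<Longrightarrow> basis H \<in> RF"
  by (simp add: RF_def supp_basis canon_Fset)

lemma wq_basis: "wf_plg H \<Longrightarrow> wq V w E \<phi> (basis H) = wdens V w E \<phi> H"
  by (simp add: wq_def supp_basis wdens_canon) (simp add: basis_def)

lemma RF_qzero: "qzero \<in> RF"
  by (simp add: RF_def supp_def qzero_def)

lemma wq_qzero: "wq V w E \<phi> qzero = 0"
  by (simp add: wq_def qzero_def)

lemma wf_empty_plg: "wf_plg empty_plg"
  by (simp add: wf_plg_def empty_plg_def pverts_def pedges_def plabs_def)

lemma wdens_edgeless:
  assumes "finite V" "sum w V = 1" "wf_plg H" "pedges H = {}"
  shows "wdens V w E \<phi> H = 1"
  using assms by (simp add: wdens_def wexp_const finite_free_verts)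

lemma one_vertex_edgeless: "one_vertex F \<Longrightarrow> pedges F = {}"
proof (rule ccontr)
  assume F: "one_vertex F" "pedges F \<noteq> {}"
  then obtain e where "e \<subseteq> pverts F" "card e = 2" "finite (pverts F)" "card (pverts F) = 1"
    by (auto simp: one_vertex_def wf_plg_def)
  then show False using card_mono[of "pverts F" e] by simp
qed

lemma diff_eq_qadd: "(\<lambda>H. f H - g H) = qadd f (qsmult (-1) g)"
  by (simp add: qadd_def qsmult_def)

text \<open>With total mass 1, one-vertex graphs and the empty graph all have density 1, so the
  generators evaluate to 0. Linearity and multiplicativity of \<open>wq\<close> carry this through
  the ideal.\<close>

lemma Kideal_RF_wq:
  assumes V: "finite V" "sum w V = 1" and a: "a \<in> Kideal"
  shows "a \<in> RF \<and> wq V w E \<phi> a = 0"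
  using a
proof induction
  case (gen F)
  have F: "wf_plg F" using gen by (simp add: one_vertex_def)
  have "pedges empty_plg = {}" by (simp add: empty_plg_def pedges_def)
  then show ?case unfolding diff_eq_qadd
    using F gen wf_empty_plg V
    by (simp add: RF_qadd RF_qsmult RF_basis wq_qadd wq_qsmult wq_basis wdens_edgeless
        one_vertex_edgeless)
qed (auto simp: RF_qzero wq_qzero RF_qadd wq_qadd RF_qsmult wq_qsmult RF_qmult wq_qmult)

lemma A_eq_wq:
  assumes "finite V" "sum w V = 1" "A_eq f g" "f \<in> RF" "g \<in> RF"
  shows "wq V w E \<phi> f = wq V w E \<phi> g"
  using Kideal_RF_wq[OF assms(1,2), of "\<lambda>H. f H - g H" E \<phi>] assms(3-)
  unfolding A_eq_def diff_eq_qadd by (simp add: RF_qsmult wq_qadd wq_qsmult)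

lemma RF_sum_sq: "set gs \<subseteq> RF \<Longrightarrow> sum_sq gs \<in> RF"
  by (induction gs) (auto simp: sum_sq_def RF_qzero RF_qadd RF_qmult)

lemma wq_sum_sq:
  "set gs \<subseteq> RF \<Longrightarrow> wq V w E \<phi> (sum_sq gs) = (\<Sum>g\<leftarrow>gs. (wq V w E \<phi> g)\<^sup>2)"
proof (induction gs)
  case Nil
  then show ?case by (simp add: sum_sq_def wq_qzero)
next
  case (Cons g gs)
  have "sum_sq (g # gs) = qadd (qmult g g) (sum_sq gs)" by (simp add: sum_sq_def)
  with Cons show ?case by (simp add: wq_qadd wq_qmult RF_qmult RF_sum_sq power2_eq_square)
qed

section \<open>Parameters realized by unlabeled quantum graphs\<close>

text \<open>One \<open>x\<close> must work for all weighted targets of total mass 1. Closure under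
  ring operations then turns any polynomial in densities into a quantum graph without expanding its
  coefficients.\<close>

definition quantum_param :: "(nat set \<Rightarrow> (nat \<Rightarrow> real) \<Rightarrow> nat set set \<Rightarrow> real) \<Rightarrow> bool" where
  "quantum_param P \<longleftrightarrow> (\<exists>x\<in>RF_L {}. \<forall>V w E \<phi>. finite V \<longrightarrow> sum w V = 1 \<longrightarrow> wq V w E \<phi> x = P V w E)"

lemma quantum_paramE:
  assumes "quantum_param P"
  obtains x where "x \<in> RF_L {}"
    "\<And>V w E \<phi>. finite V \<Longrightarrow> sum w V = 1 \<Longrightarrow> wq V w E \<phi> x = P V w E"
  using assms unfolding quantum_param_def by blast

lemma quantum_param_add:
  assumes "quantum_param P" "quantum_param Q"
  shows "quantum_param (\<lambda>V w E. P V w E + Q V w E)"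
proof -
  obtain x where x: "x \<in> RF_L {}"
    and evx: "\<And>V w E \<phi>. finite V \<Longrightarrow> sum w V = 1 \<Longrightarrow> wq V w E \<phi> x = P V w E"
    using quantum_paramE[OF assms(1)] by blast
  obtain y where y: "y \<in> RF_L {}"
    and evy: "\<And>V w E \<phi>. finite V \<Longrightarrow> sum w V = 1 \<Longrightarrow> wq V w E \<phi> y = Q V w E"
    using quantum_paramE[OF assms(2)] by blast
  note xy = x y and ev = evx evy
  have "qadd x y \<in> RF_L {}"
    using xy supp_qadd[of x y] by (auto simp: RF_L_def RF_qadd)
  with xy ev show ?thesis unfolding quantum_param_def
    by (intro bexI[of _ "qadd x y"]) (auto simp: RF_L_def wq_qadd)
qed

lemma quantum_param_mult:
  assumes "quantum_param P" "quantum_param Q"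
  shows "quantum_param (\<lambda>V w E. P V w E * Q V w E)"
proof -
  obtain x where x: "x \<in> RF_L {}"
    and evx: "\<And>V w E \<phi>. finite V \<Longrightarrow> sum w V = 1 \<Longrightarrow> wq V w E \<phi> x = P V w E"
    using quantum_paramE[OF assms(1)] by blast
  obtain y where y: "y \<in> RF_L {}"
    and evy: "\<And>V w E \<phi>. finite V \<Longrightarrow> sum w V = 1 \<Longrightarrow> wq V w E \<phi> y = Q V w E"
    using quantum_paramE[OF assms(2)] by blast
  note xy = x y and ev = evx evy
  have RF: "x \<in> RF" "y \<in> RF" using xy by (auto simp: RF_L_def)
  have "dom (plabs H) = {}" if H: "H \<in> supp (qmult x y)" for H
  proof -
    obtain A B where "A \<in> supp x" "B \<in> supp y" "H = canon (glue A B)"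
      using supp_qmult[OF RF] H by auto
    with xy show ?thesis by (simp add: RF_L_def dom_plabs_canon dom_plabs_glue del: dom_eq_empty_conv)
  qed
  then have "qmult x y \<in> RF_L {}" using RF by (simp add: RF_L_def RF_qmult)
  with RF ev show ?thesis unfolding quantum_param_def
    by (intro bexI[of _ "qmult x y"]) (auto simp: wq_qmult)
qed

lemma quantum_param_wdens:
  assumes "wf_plg H" "plabs H = Map.empty"
  shows "quantum_param (\<lambda>V w E. wdens V w E (\<lambda>_. 0) H)"
proof -
  have "basis H \<in> RF_L {}"
    using assms dom_plabs_canon[of H] by (simp add: RF_L_def RF_basis supp_basis)
  moreover have "wq V w E \<phi> (basis H) = wdens V w E (\<lambda>_. 0) H" for V w E \<phi>
    using assms by (simp add: wq_basis) (rule wdens_cong_labels, auto)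
  ultimately show ?thesis unfolding quantum_param_def by blast
qed

lemma quantum_param_const: "quantum_param (\<lambda>_ _ _. c)"
proof -
  have e: "plabs empty_plg = Map.empty" "pedges empty_plg = {}"
    by (simp_all add: empty_plg_def plabs_def pedges_def)
  have RF: "basis empty_plg \<in> RF" by (simp add: RF_basis wf_empty_plg)
  have "qsmult c (basis empty_plg) \<in> RF_L {}"
    using supp_qsmult[of c "basis empty_plg"] RF dom_plabs_canon[of empty_plg] e
    by (auto simp: RF_L_def supp_basis RF_qsmult)
  moreover have "wq V w E \<phi> (qsmult c (basis empty_plg)) = c"
    if "finite V" "sum w V = 1" for V w E \<phi>
    using that e RF by (simp add: wq_qsmult wq_basis wf_empty_plg wdens_edgeless)
  ultimately show ?thesis unfolding quantum_param_def by blast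
qed

lemma quantum_param_diff:
  assumes "quantum_param P" "quantum_param Q"
  shows "quantum_param (\<lambda>V w E. P V w E - Q V w E)"
  using quantum_param_add[OF assms(1) quantum_param_mult[OF quantum_param_const[of "-1"] assms(2)]]
  by simp

lemma quantum_param_power:
  assumes "quantum_param P"
  shows "quantum_param (\<lambda>V w E. P V w E ^ n)"
  by (induction n) (simp_all add: quantum_param_const quantum_param_mult assms)

text \<open>Uniform weights turn \<open>wq\<close> into \<open>tq\<close>, which gives positivity.
  The values at all other weights are handed on, since the refutation of sums of squares takes place
  there.\<close>

lemma quantum_param_nonneg:
  assumes P: "quantum_param P" and nonneg: "\<And>V w E. P V w E \<ge> 0"
  obtains x where "x \<in> RF_L {}" "positive_L {} x"
    "\<And>V w E \<phi>. finite V \<Longrightarrow> sum w V = 1 \<Longrightarrow> wq V w E \<phi> x = P V w E"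
proof -
  obtain x where x: "x \<in> RF_L {}"
    and ev: "\<And>V w E \<phi>. finite V \<Longrightarrow> sum w V = 1 \<Longrightarrow> wq V w E \<phi> x = P V w E"
    using quantum_paramE[OF P] by blast
  have "tq x V E \<phi> \<ge> 0" if G: "is_graph V E" for V E \<phi>
  proof -
    \<comment> \<open>A graph has a vertex, so the uniform weights do sum to 1.\<close>
    have V: "finite V" "sum (\<lambda>_. 1 / real (card V)) V = 1"
      using G by (auto simp: is_graph_def)
    have "tq x V E \<phi> = wq V (\<lambda>_. 1 / real (card V)) E \<phi> x"
      unfolding tq_def wq_def using x V RF_wf[of x]
      by (intro sum.cong refl) (auto simp: RF_L_def tdens_eq_wdens)
    then show ?thesis using ev[OF V] nonneg by simp
  qed
  then have "positive_L {} x" by (simp add: positive_L_def)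
  then show thesis using that x ev by blast
qed

section \<open>Polynomials on the three-by-three grid\<close>

text \<open>Building polynomials from monomials by addition reduces the linear grid identity to a
  check on monomials.\<close>

inductive polyfun3 :: "(real \<Rightarrow> real \<Rightarrow> real \<Rightarrow> real) \<Rightarrow> bool" where
  monom: "polyfun3 (\<lambda>x y z. c * x ^ i * y ^ j * z ^ k)"
| add: "polyfun3 f \<Longrightarrow> polyfun3 g \<Longrightarrow> polyfun3 (\<lambda>x y z. f x y z + g x y z)"

lemma polyfun3_const: "polyfun3 (\<lambda>x y z. c)"
  using polyfun3.monom[of c 0 0 0] by simp

lemma polyfun3_coords:
  "polyfun3 (\<lambda>x y z. x)" "polyfun3 (\<lambda>x y z. y)" "polyfun3 (\<lambda>x y z. z)"
  using polyfun3.monom[of 1 1 0 0] polyfun3.monom[of 1 0 1 0] polyfun3.monom[of 1 0 0 1] by simp_all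

lemma polyfun3_mult:
  assumes "polyfun3 f" "polyfun3 g"
  shows "polyfun3 (\<lambda>x y z. f x y z * g x y z)"
  using assms(1)
proof induction
  case (monom c i j k)
  show ?case using assms(2)
  proof induction
    case (monom c' i' j' k')
    show ?case
      using polyfun3.monom[of "c * c'" "i + i'" "j + j'" "k + k'"] by (simp add: power_add mult_ac)
  next
    case (add f g)
    then show ?case using polyfun3.add[OF add(3,4)] by (simp add: distrib_left)
  qed
next
  case (add f' g')
  then show ?case using polyfun3.add[OF add(3,4)] by (simp add: distrib_right)
qed

lemma polyfun3_diff:
  assumes "polyfun3 f" "polyfun3 g"
  shows "polyfun3 (\<lambda>x y z. f x y z - g x y z)"
  using polyfun3.add[OF assms(1) polyfun3_mult[OF polyfun3_const[of "-1"] assms(2)]] by simp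

lemma polyfun3_sum:
  "(\<And>i. i \<in> I \<Longrightarrow> polyfun3 (f i)) \<Longrightarrow> polyfun3 (\<lambda>x y z. \<Sum>i\<in>I. f i x y z)"
  by (induction I rule: infinite_finite_induct) (auto simp: polyfun3_const intro: polyfun3.add)

lemma polyfun3_prod:
  "(\<And>i. i \<in> I \<Longrightarrow> polyfun3 (f i)) \<Longrightarrow> polyfun3 (\<lambda>x y z. \<Prod>i\<in>I. f i x y z)"
  by (induction I rule: infinite_finite_induct) (auto simp: polyfun3_const intro: polyfun3_mult)

text \<open>The tensor square of the second difference operator annihilates all polynomials of degree
  at most three in two variables, hence only terms of total degree at least four survive.\<close>

definition grid_weight :: "real \<Rightarrow> real" where
  "grid_weight a = (if a = 0 then -2 else 1)"

lemma grid_moment: "(\<Sum>a\<in>{-1,0,1}. grid_weight a * a ^ i) = (if even i \<and> i \<noteq> 0 then 2 else 0)"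
  by (simp add: grid_weight_def power_0_left minus_one_power_iff)

text \<open>On a monomial the double sum factors into two moments. It is either identically 0, or
  both \<open>i\<close> and \<open>j\<close> are at least 2 and a positive power of \<open>s\<close>
  survives the division by \<open>s ^ 3\<close>.\<close>

lemma polyfun3_grid_limit:
  assumes "polyfun3 f"
  shows "((\<lambda>s. \<Sum>a\<in>{-1,0,1}. \<Sum>b\<in>{-1,0,1}.
      grid_weight a * grid_weight b * (f (s * a) (s * b) s / s ^ 3)) \<longlongrightarrow> 0) (at_right 0)"
  using assms
proof induction
  case (monom c i j k)
  let ?m = "\<lambda>i. \<Sum>a\<in>{-1,0,1}. grid_weight a * a ^ i"
  have eq: "(\<Sum>a\<in>{-1,0,1}. \<Sum>b\<in>{-1,0,1}. grid_weight a * grid_weight b *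
      (c * (s * a) ^ i * (s * b) ^ j * s ^ k / s ^ 3)) = c * (?m i * ?m j) * (s ^ (i + j + k) / s ^ 3)" for s
  proof -
    have "(\<Sum>a\<in>{-1,0,1}. \<Sum>b\<in>{-1,0,1}. grid_weight a * grid_weight b *
        (c * (s * a) ^ i * (s * b) ^ j * s ^ k / s ^ 3)) =
      (\<Sum>a\<in>{-1,0,1}. \<Sum>b\<in>{-1,0,1}. c * (s ^ (i + j + k) / s ^ 3) *
        ((grid_weight a * a ^ i) * (grid_weight b * b ^ j)))"
      by (intro sum.cong refl) (simp add: power_mult_distrib power_add)
    also have "\<dots> = c * (s ^ (i + j + k) / s ^ 3) * (?m i * ?m j)"
      by (subst sum_product) (simp only: sum_distrib_left)
    finally show ?thesis by (simp only: mult_ac)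
  qed
  show ?case
  proof (cases "even i \<and> i \<noteq> 0 \<and> even j \<and> j \<noteq> 0")
    case False
    then have z: "?m i * ?m j = 0" unfolding grid_moment by auto
    show ?thesis unfolding eq z by simp
  next
    case True
    then have "2 \<le> i" "2 \<le> j" by (auto elim!: evenE)
    \<comment> \<open>Truncated subtraction is exact here because \<open>i + j\<close> is at least
      4.\<close>
    moreover define n where "n = i + j + k - 4"
    ultimately have n: "i + j + k = Suc n + 3" by simp
    define K where "K = c * (?m i * ?m j)"
    have "((\<lambda>s. K * s ^ Suc n) \<longlongrightarrow> K * 0 ^ Suc n) (at_right 0)"
      by (intro tendsto_intros)
    then have "((\<lambda>s. K * s ^ Suc n) \<longlongrightarrow> 0) (at_right 0)" by simp
    then show ?thesis unfolding eq n K_def[symmetric]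
      by (rule Lim_transform_eventually)
        (auto intro!: eventually_at_right_less[THEN eventually_mono]
          simp: power_add power_numeral_reduce)
  qed
next
  case (add f g)
  show ?case
    using tendsto_add[OF add(3,4)]
    by (simp only: add_divide_distrib distrib_left sum.distrib) simp
qed

text \<open>The multipliers \<open>c\<close> will be the weights of label placements. They vary with
  the point, but have positive limits along every ray in a direction \<open>(a, b, 1)\<close>, so
  close to the base point the squares cannot cancel each other.\<close>

lemma local_sos_ninth_point:
  fixes G c :: "'i \<Rightarrow> real \<Rightarrow> real \<Rightarrow> real \<Rightarrow> real"
  assumes I: "finite I"
    and G: "\<And>i. i \<in> I \<Longrightarrow> polyfun3 (G i)"
    and c: "\<And>i a b. i \<in> I \<Longrightarrow> ((\<lambda>s. c i (s * a) (s * b) s) \<longlongrightarrow> c0 i) (at_right 0)"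
    and c0: "\<And>i. i \<in> I \<Longrightarrow> c0 i > 0"
    and F: "\<And>a b. ((\<lambda>s. (\<Sum>i\<in>I. c i (s * a) (s * b) s * (G i (s * a) (s * b) s)\<^sup>2) / s ^ 6)
              \<longlongrightarrow> R a b) (at_right 0)"
    and R: "\<And>a b. a \<in> {-1,0,1} \<Longrightarrow> b \<in> {-1,0,1} \<Longrightarrow> (a, b) \<noteq> (0, 0) \<Longrightarrow> R a b = 0"
  shows "R 0 0 = 0"
proof -
  have sq: "(G i x y s / s ^ 3)\<^sup>2 = (G i x y s)\<^sup>2 / s ^ 6" for i x y s
    by (simp add: power_divide flip: power_mult)
  have small: "((\<lambda>s. G i (s * a) (s * b) s / s ^ 3) \<longlongrightarrow> 0) (at_right 0)"
    if i: "i \<in> I" and ab: "a \<in> {-1,0,1}" "b \<in> {-1,0,1}" "(a, b) \<noteq> (0, 0)" for i a b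
  proof -
    let ?F = "\<lambda>s. \<Sum>i\<in>I. c i (s * a) (s * b) s * (G i (s * a) (s * b) s)\<^sup>2"
    have pos: "\<forall>\<^sub>F s in at_right 0. \<forall>j\<in>I. c j (s * a) (s * b) s > 0"
      using I order_tendstoD(1)[OF c c0] by (intro eventually_ball_finite) auto
    have lim: "((\<lambda>s. (?F s / s ^ 6) / c i (s * a) (s * b) s) \<longlongrightarrow> 0 / c0 i) (at_right 0)"
      using F[of a b] R[OF ab] c[OF i] c0[OF i] by (intro tendsto_divide) auto
    \<comment> \<open>For small \<open>s\<close> every summand is nonnegative, so each one is
      bounded by the whole sum, which is \<open>o(s^6)\<close> on the eight rays.\<close>
    have bound: "\<forall>\<^sub>F s in at_right 0. (G i (s * a) (s * b) s / s ^ 3)\<^sup>2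
        \<le> (?F s / s ^ 6) / c i (s * a) (s * b) s"
      using pos
    proof eventually_elim
      case (elim s)
      then have ci: "c i (s * a) (s * b) s > 0" using i by auto
      have "c i (s * a) (s * b) s * (G i (s * a) (s * b) s)\<^sup>2 \<le> ?F s"
        using I i elim by (intro member_le_sum mult_nonneg_nonneg zero_le_power2) (auto intro: less_imp_le)
      then have "(c i (s * a) (s * b) s * (G i (s * a) (s * b) s)\<^sup>2) / s ^ 6 / c i (s * a) (s * b) s
          \<le> (?F s / s ^ 6) / c i (s * a) (s * b) s"
        using ci by (intro divide_right_mono) auto
      then show ?case unfolding sq using ci by simp
    qed
    have "((\<lambda>s. (G i (s * a) (s * b) s / s ^ 3)\<^sup>2) \<longlongrightarrow> 0) (at_right 0)"
      using lim by (intro tendsto_sandwich[OF _ bound tendsto_const]) auto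
    then have "((\<lambda>s. sqrt ((G i (s * a) (s * b) s / s ^ 3)\<^sup>2)) \<longlongrightarrow> sqrt 0) (at_right 0)"
      by (rule tendsto_real_sqrt)
    then show ?thesis unfolding real_sqrt_abs real_sqrt_zero tendsto_rabs_zero_iff .
  qed
  have ninth: "((\<lambda>s. G i (s * 0) (s * 0) s / s ^ 3) \<longlongrightarrow> 0) (at_right 0)" if i: "i \<in> I" for i
  proof -
    let ?g = "\<lambda>a b s. G i (s * a) (s * b) s / s ^ 3"
    let ?S = "\<lambda>s. \<Sum>a\<in>{-1,0,1}. \<Sum>b\<in>{-1,0,1}. grid_weight a * grid_weight b * ?g a b s"
    have "((\<lambda>s. \<Sum>a\<in>{-1,0,1}. \<Sum>b\<in>{-1,0,1}. grid_weight a * grid_weight b *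
        (if (a, b) = (0, 0) then 0 else ?g a b s)) \<longlongrightarrow>
        (\<Sum>a\<in>{-1,0,1::real}. \<Sum>b\<in>{-1,0,1::real}. grid_weight a * grid_weight b * 0)) (at_right 0)"
    proof (intro tendsto_sum tendsto_mult tendsto_const)
      fix a b :: real assume "a \<in> {-1,0,1}" "b \<in> {-1,0,1}"
      then show "((\<lambda>s. if (a, b) = (0, 0) then 0 else ?g a b s) \<longlongrightarrow> 0) (at_right 0)"
        using small[OF i, of a b] by (cases "(a, b) = (0, 0)") auto
    qed
    \<comment> \<open>The two sums differ only at the center of the grid, whose weight is
      \<open>(-2) * (-2) = 4\<close>.\<close>
    then have "((\<lambda>s. (?S s - (\<Sum>a\<in>{-1,0,1}. \<Sum>b\<in>{-1,0,1}. grid_weight a * grid_weight b *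
        (if (a, b) = (0, 0) then 0 else ?g a b s))) / 4) \<longlongrightarrow> (0 - 0) / 4) (at_right 0)"
      by (intro tendsto_divide tendsto_diff polyfun3_grid_limit G i tendsto_const) auto
    moreover have "(?S s - (\<Sum>a\<in>{-1,0,1}. \<Sum>b\<in>{-1,0,1}. grid_weight a * grid_weight b *
        (if (a, b) = (0, 0) then 0 else ?g a b s))) / 4 = ?g 0 0 s" for s
      by (simp add: grid_weight_def)
    ultimately show ?thesis by simp
  qed
  have "((\<lambda>s. \<Sum>i\<in>I. c i (s * 0) (s * 0) s * (G i (s * 0) (s * 0) s / s ^ 3)\<^sup>2) \<longlongrightarrow>
      (\<Sum>i\<in>I. c0 i * 0\<^sup>2)) (at_right 0)"
    by (intro tendsto_sum tendsto_mult tendsto_power c ninth)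
  then have "((\<lambda>s. (\<Sum>i\<in>I. c i (s * 0) (s * 0) s * (G i (s * 0) (s * 0) s)\<^sup>2) / s ^ 6) \<longlongrightarrow> 0)
      (at_right 0)"
    unfolding sq sum_divide_distrib by simp
  then show ?thesis using F[of 0 0] tendsto_unique[OF trivial_limit_at_right_real] by blast
qed

section \<open>A positive quantum graph that is not a sum of squares\<close>

definition star_plg :: "nat \<Rightarrow> plg" where
  "star_plg n = ({..n}, (\<lambda>i. {0, i}) ` {1..n}, Map.empty)"

lemma star_plg_simps:
  "pverts (star_plg n) = {..n}" "pedges (star_plg n) = (\<lambda>i. {0, i}) ` {1..n}"
  "plabs (star_plg n) = Map.empty"
  by (simp_all add: star_plg_def pverts_def pedges_def plabs_def)

lemma wf_star_plg: "wf_plg (star_plg n)"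
  by (auto simp: wf_plg_def star_plg_simps)

text \<open>The target consists of isolated vertices. Three of them carry loops and have free weights near
  \<open>(1/10, 1/5, 3/10)\<close>; the loopless vertex 0 absorbs the remaining weight.\<close>

definition loop_weight :: "real \<Rightarrow> real \<Rightarrow> real \<Rightarrow> nat \<Rightarrow> real" where
  "loop_weight x y z v = (if v = 1 then 1/10 + x else if v = 2 then 1/5 + y
     else if v = 3 then 3/10 + z else 2/5 - x - y - z)"

abbreviation loop_verts :: "nat set" where "loop_verts \<equiv> {0, 1, 2, 3}"
abbreviation loop_edges :: "nat set set" where "loop_edges \<equiv> {{1}, {2}, {3}}"

lemma sum_loop_weight: "sum (loop_weight x y z) loop_verts = 1"
  by (simp add: loop_weight_def)

text \<open>A connected graph is mapped to a single isolated vertex, which must carry a loop because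
  there is at least one edge. The \<open>n + 1\<close> vertices of the star give the
  exponent.\<close>

lemma wdens_star_loops:
  assumes "n \<ge> 1"
  shows "wdens loop_verts (loop_weight x y z) loop_edges \<phi> (star_plg n) =
    (1/10 + x) ^ Suc n + (1/5 + y) ^ Suc n + (3/10 + z) ^ Suc n"
proof -
  let ?w = "loop_weight x y z"
  have free: "free_verts (star_plg n) = {..n}" by (simp add: free_verts_def star_plg_simps)
  let ?hom = "\<lambda>f. \<forall>e\<in>pedges (star_plg n). place (star_plg n) \<phi> f ` e \<in> loop_edges"
  have hom: "?hom f \<longleftrightarrow> (\<forall>i\<in>{1..n}. {f 0, f i} \<in> loop_edges)" for f
    by (auto simp: star_plg_simps place_free free)
  let ?k = "\<lambda>c. \<lambda>i\<in>{..n}. c :: nat"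
  have eq: "{f \<in> {..n} \<rightarrow>\<^sub>E loop_verts. ?hom f} = ?k ` {1,2,3}" (is "?A = ?B")
  proof (intro equalityI subsetI)
    fix f assume "f \<in> ?A"
    then have f: "f \<in> {..n} \<rightarrow>\<^sub>E loop_verts" and h: "\<And>i. i \<in> {1..n} \<Longrightarrow> {f 0, f i} \<in> loop_edges"
      by (simp_all only: hom mem_Collect_eq)
    have const: "f i = f 0" if "i \<le> n" for i
      using h[of i] that by (cases "i = 0") (auto simp: doubleton_eq_iff)
    have "f = ?k (f 0)"
    proof
      show "f i = ?k (f 0) i" for i
        using const[of i] PiE_arb[OF f, of i] by (cases "i \<le> n") simp_all
    qed
    moreover have "f 0 \<in> {1,2,3}" using h[of 1] assms by (auto simp: doubleton_eq_iff)
    ultimately show "f \<in> ?B" by blast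
  next
    fix f assume "f \<in> ?B"
    then obtain c where c: "c \<in> {1,2,3}" "f = ?k c" by blast
    have "f \<in> {..n} \<rightarrow>\<^sub>E loop_verts"
      unfolding c(2) restrict_PiE_iff using c(1) by auto
    moreover have "?hom f" unfolding hom using c by auto
    ultimately show "f \<in> ?A" by blast
  qed
  have inj: "inj_on ?k {1,2,3}"
    by (rule inj_onI) (metis atMost_iff le0 restrict_apply')
  have "wdens loop_verts ?w loop_edges \<phi> (star_plg n) =
      (\<Sum>f\<in>{..n} \<rightarrow>\<^sub>E loop_verts. if ?hom f then \<Prod>u\<le>n. ?w (f u) else 0)"
    unfolding wdens_def wexp_def free by (intro sum.cong) auto
  also have "\<dots> = (\<Sum>f\<in>{f \<in> {..n} \<rightarrow>\<^sub>E loop_verts. ?hom f}. \<Prod>u\<le>n. ?w (f u))"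
    by (rule sum.inter_filter[symmetric]) (simp add: finite_PiE)
  also have "\<dots> = (\<Sum>c\<in>{1,2,3}. \<Prod>u\<le>n. ?w (?k c u))"
    unfolding eq by (subst sum.reindex[OF inj]) simp
  also have "\<dots> = (\<Sum>c\<in>{1,2,3}. ?w c ^ Suc n)"
    by (intro sum.cong refl) simp
  finally show ?thesis by (simp add: loop_weight_def)
qed

lemma polyfun3_loop_weight: "polyfun3 (\<lambda>x y z. loop_weight x y z v)"
  unfolding loop_weight_def
  by (cases "v = 1"; cases "v = 2"; cases "v = 3")
    (simp_all add: polyfun3.add polyfun3_diff polyfun3_const polyfun3_coords)

text \<open>For a fixed target each density is a finite sum of products of weights, and these
  weights are affine in the three parameters.\<close>

lemma polyfun3_wq: "polyfun3 (\<lambda>x y z. wq V (loop_weight x y z) E \<phi> g)"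
  unfolding wq_def wdens_def wexp_def
  by (intro polyfun3_sum polyfun3_mult polyfun3_const polyfun3_prod polyfun3_loop_weight)

section \<open>Schur's inequality and the Robinson parameter\<close>

definition schur :: "real \<Rightarrow> real \<Rightarrow> real \<Rightarrow> real" where
  "schur A B C = A * (A - B) * (A - C) + B * (B - A) * (B - C) + C * (C - A) * (C - B)"

text \<open>By symmetry one may order the arguments as \<open>A \<ge> B \<ge> C\<close>. Then
  \<open>A * (A - C)\<close> dominates \<open>B * (B - C)\<close>, and the remaining term is a
  product of nonnegative factors.\<close>

lemma schur_nonneg:
  assumes "A \<ge> 0" "B \<ge> 0" "C \<ge> 0"
  shows "schur A B C \<ge> 0"
proof -
  have ordered: "schur A B C \<ge> 0" if "A \<ge> B" "B \<ge> C" "C \<ge> 0" for A B C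
  proof -
    have "schur A B C = (A - B) * (A * (A - C) - B * (B - C)) + C * ((A - C) * (B - C))"
      by (simp add: schur_def algebra_simps)
    moreover have "B * (B - C) \<le> A * (A - C)" using that by (intro mult_mono) auto
    ultimately show ?thesis using that by simp
  qed
  have sym: "schur A B C = schur B A C" "schur A B C = schur A C B" for A B C
    by (simp_all add: schur_def algebra_simps)
  show ?thesis
    using ordered[of A B C] ordered[of A C B] ordered[of B A C] ordered[of B C A] ordered[of C A B]
      ordered[of C B A] sym assms by (metis linear)
qed

text \<open>\<open>schur\<close> is homogeneous of degree three, hence of degree six in the
  variables that are squared.\<close>

lemma schur_scale: "s \<noteq> 0 \<Longrightarrow> schur (A\<^sup>2) (B\<^sup>2) (C\<^sup>2) / s ^ 6 = schur ((A/s)\<^sup>2) ((B/s)\<^sup>2) ((C/s)\<^sup>2)"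
  by (simp add: schur_def power_divide field_simps power_numeral_reduce)

text \<open>\<open>param_coord c4 c3 c2 c0\<close> at weights \<open>(w\<^sub>1, w\<^sub>2, w\<^sub>3)\<close> is the sum of \<open>h w\<^sub>i\<close> for
  \<open>h w = c4 w^4 + c3 w^3 + c2 w^2\<close>, plus \<open>c0\<close>. The constants below make it vanish at
  \<open>(1/10, 1/5, 3/10)\<close> and make \<open>h'\<close> equal to 1 at one of these three points and 0 at the others.\<close>

definition param_coord :: "real \<Rightarrow> real \<Rightarrow> real \<Rightarrow> real \<Rightarrow> nat set \<Rightarrow> (nat \<Rightarrow> real) \<Rightarrow> nat set set \<Rightarrow> real" where
  "param_coord c4 c3 c2 c0 V w E = c4 * wdens V w E (\<lambda>_. 0) (star_plg 3) +
     c3 * wdens V w E (\<lambda>_. 0) (star_plg 2) + c2 * wdens V w E (\<lambda>_. 0) (star_plg 1) + c0"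

lemma quantum_param_coord: "quantum_param (param_coord c4 c3 c2 c0)"
  unfolding param_coord_def[abs_def]
  by (intro quantum_param_add quantum_param_mult quantum_param_const quantum_param_wdens
      wf_star_plg star_plg_simps)

text \<open>Since \<open>h\<close> has no linear term, \<open>h'\<close> also vanishes at 0. The
  three \<open>h'\<close> are thus the Lagrange cubics for the nodes 0, 1/10, 1/5, 3/10, which is
  why stars with up to three edges are used.\<close>

abbreviation "coord1 \<equiv> param_coord 125 (-250/3) 15 (-13/40)"
abbreviation "coord2 \<equiv> param_coord (-125) (200/3) (-15/2) (-1/8)"
abbreviation "coord3 \<equiv> param_coord (125/3) (-50/3) (5/3) (-1/24)"

lemma param_coord_limit:
  fixes a b :: real
  defines "w \<equiv> \<lambda>s. loop_weight (s * a) (s * b) s"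
  shows "((\<lambda>s. coord1 loop_verts (w s) loop_edges / s) \<longlongrightarrow> a) (at_right 0)"
    and "((\<lambda>s. coord2 loop_verts (w s) loop_edges / s) \<longlongrightarrow> b) (at_right 0)"
    and "((\<lambda>s. coord3 loop_verts (w s) loop_edges / s) \<longlongrightarrow> 1) (at_right 0)"
proof -
  let ?q = "\<lambda>c4 c3 c2 c0 s. param_coord c4 c3 c2 c0 loop_verts (w s) loop_edges"
  have q: "?q c4 c3 c2 c0 s =
     c4 * ((1/10 + s * a)^4 + (1/5 + s * b)^4 + (3/10 + s)^4) +
     c3 * ((1/10 + s * a)^3 + (1/5 + s * b)^3 + (3/10 + s)^3) +
     c2 * ((1/10 + s * a)^2 + (1/5 + s * b)^2 + (3/10 + s)^2) + c0" for c4 c3 c2 c0 s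
  proof -
    have n: "1 \<le> (1::nat)" "1 \<le> (2::nat)" "1 \<le> (3::nat)" and
      Suc: "Suc 1 = 2" "Suc 2 = 3" "Suc 3 = 4" by simp_all
    show ?thesis unfolding param_coord_def w_def n[THEN wdens_star_loops] Suc ..
  qed
  \<comment> \<open>The numbers 49/5000, 9/250 and 7/50 are the power sums of degrees 4, 3 and 2 at
    the base point, so \<open>c0\<close> cancels the value there. \<open>D\<close> is the derivative
    in the direction \<open>(a, b, 1)\<close>.\<close>
  have lim: "((\<lambda>s. ?q c4 c3 c2 c0 s / s) \<longlongrightarrow> D) (at_right 0)"
    if "c0 = - (c4 * 49 / 5000 + c3 * 9 / 250 + c2 * 7 / 50)"
      "D = c4 * (4 * a / 1000 + 4 * b / 125 + 108 / 1000) +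
           c3 * (3 * a / 100 + 3 * b / 25 + 27 / 100) + c2 * (2 * a / 10 + 2 * b / 5 + 6 / 10)"
    for c4 c3 c2 c0 D
  proof -
    have zero: "?q c4 c3 c2 c0 0 = 0"
      unfolding q that(1) by (simp add: power_numeral_reduce)
    have "((\<lambda>s. ?q c4 c3 c2 c0 s) has_real_derivative D) (at 0)"
      unfolding q that(2)
      by (auto intro!: derivative_eq_intros simp: field_simps power_numeral_reduce)
    then have "((\<lambda>s. ?q c4 c3 c2 c0 s / s) \<longlongrightarrow> D) (at 0)"
      using zero by (simp add: has_field_derivative_iff)
    then show ?thesis by (rule filterlim_mono) (auto simp: at_le)
  qed
  show "((\<lambda>s. coord1 loop_verts (w s) loop_edges / s) \<longlongrightarrow> a) (at_right 0)"
    by (rule lim) (simp_all add: algebra_simps)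
  show "((\<lambda>s. coord2 loop_verts (w s) loop_edges / s) \<longlongrightarrow> b) (at_right 0)"
    by (rule lim) (simp_all add: algebra_simps)
  show "((\<lambda>s. coord3 loop_verts (w s) loop_edges / s) \<longlongrightarrow> 1) (at_right 0)"
    by (rule lim) (simp_all add: algebra_simps)
qed

definition robinson_param :: "nat set \<Rightarrow> (nat \<Rightarrow> real) \<Rightarrow> nat set set \<Rightarrow> real" where
  "robinson_param V w E = schur ((coord1 V w E)\<^sup>2) ((coord2 V w E)\<^sup>2) ((coord3 V w E)\<^sup>2)"

lemma quantum_param_robinson: "quantum_param robinson_param"
  unfolding robinson_param_def[abs_def] schur_def
  by (intro quantum_param_add quantum_param_mult quantum_param_diff quantum_param_power
      quantum_param_coord)

text \<open>By homogeneity, dividing by \<open>s ^ 6\<close> divides each coordinate by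
  \<open>s\<close>, and these quotients tend to \<open>a\<close>, \<open>b\<close> and 1.\<close>

lemma robinson_param_limit:
  "((\<lambda>s. robinson_param loop_verts (loop_weight (s * a) (s * b) s) loop_edges / s ^ 6)
     \<longlongrightarrow> schur (a\<^sup>2) (b\<^sup>2) 1) (at_right 0)"
proof -
  let ?c = "\<lambda>q s. q loop_verts (loop_weight (s * a) (s * b) s) loop_edges / s :: real"
  have "((\<lambda>s. schur ((?c coord1 s)\<^sup>2) ((?c coord2 s)\<^sup>2) ((?c coord3 s)\<^sup>2)) \<longlongrightarrow> schur (a\<^sup>2) (b\<^sup>2) (1\<^sup>2)) (at_right 0)"
    unfolding schur_def by (intro tendsto_intros param_coord_limit)
  then have "((\<lambda>s. schur ((?c coord1 s)\<^sup>2) ((?c coord2 s)\<^sup>2) ((?c coord3 s)\<^sup>2)) \<longlongrightarrow> schur (a\<^sup>2) (b\<^sup>2) 1) (at_right 0)"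
    by simp
  then show ?thesis
    by (rule Lim_transform_eventually)
      (auto intro!: eventually_at_right_less[THEN eventually_mono] simp: robinson_param_def schur_scale)
qed

theorem theorem2p2:
  shows "\<exists>x \<in> RF_L {}. positive_L {} x \<and>
           \<not> (\<exists>gs. set gs \<subseteq> RF \<and> A_eq x (qunlabel {} (sum_sq gs)))"
proof -
  have "robinson_param V w E \<ge> 0" for V w E
    unfolding robinson_param_def by (intro schur_nonneg) auto
  then obtain x where x: "x \<in> RF_L {}" "positive_L {} x"
    and ev: "\<And>V w E \<phi>. finite V \<Longrightarrow> sum w V = 1 \<Longrightarrow> wq V w E \<phi> x = robinson_param V w E"
    using quantum_param_nonneg[OF quantum_param_robinson] by blast
  have False if gs: "set gs \<subseteq> RF" and eq: "A_eq x (qunlabel {} (sum_sq gs))" for gs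
  proof -
    let ?V = loop_verts and ?E = loop_edges
    define L where "L = (\<Union>H\<in>supp (sum_sq gs). dom (plabs H))"
    \<comment> \<open>An index is a placement of the labels together with a position in
      \<open>gs\<close>. The multiplier \<open>c\<close> is the weight of the placement, and
      \<open>G\<close> is the value of the chosen \<open>g\<close> under it.\<close>
    define I where "I = (L \<rightarrow>\<^sub>E ?V) \<times> {..<length gs}"
    define G where "G = (\<lambda>(\<phi>, i) x y z. wq ?V (loop_weight x y z) ?E \<phi> (gs ! i))"
    define c where "c = (\<lambda>(\<phi>, i :: nat) x y z. \<Prod>l\<in>L. loop_weight x y z (\<phi> l))"
    have RF: "sum_sq gs \<in> RF" using gs by (rule RF_sum_sq)
    have L: "finite L"
      unfolding L_def using RF_finite[OF RF] RF_wf[OF RF] by (auto simp: wf_plg_def)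
    \<comment> \<open>Unlabeling averages over the placements, and under each placement
      \<open>sum_sq gs\<close> evaluates to a sum of squares.\<close>
    have sos: "robinson_param ?V (loop_weight x y z) ?E = (\<Sum>p\<in>I. c p x y z * (G p x y z)\<^sup>2)" for x y z
    proof -
      let ?w = "loop_weight x y z"
      have "robinson_param ?V ?w ?E = wq ?V ?w ?E (\<lambda>_. 0) (qunlabel {} (sum_sq gs))"
        using ev[of ?V ?w ?E "\<lambda>_. 0"] A_eq_wq[OF _ sum_loop_weight eq _ RF_qunlabel[OF RF]] x
          sum_loop_weight by (simp add: RF_L_def)
      also have "\<dots> = wexp ?V ?w L (\<lambda>\<phi>. wq ?V ?w ?E \<phi> (sum_sq gs))"
        by (rule wq_qunlabel[OF _ sum_loop_weight RF L]) (auto simp: L_def)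
      \<comment> \<open>This identity holds for every \<phi>, whatever value \<phi> takes at labels
        outside \<open>L\<close>.\<close>
      also have "\<dots> = wexp ?V ?w L (\<lambda>\<phi>. \<Sum>i<length gs. (wq ?V ?w ?E \<phi> (gs ! i))\<^sup>2)"
        using gs by (simp add: wq_sum_sq sum_list_sum_nth atLeast0LessThan)
      also have "\<dots> = (\<Sum>p\<in>I. c p x y z * (G p x y z)\<^sup>2)"
        by (simp add: wexp_def I_def c_def G_def sum_distrib_left sum.cartesian_product case_prod_unfold)
      finally show ?thesis .
    qed
    have "schur (0\<^sup>2) (0\<^sup>2) 1 = 0"
    proof (rule local_sos_ninth_point[where R = "\<lambda>a b. schur (a\<^sup>2) (b\<^sup>2) 1" and I = I and G = G
          and c = c and ?c0.0 = "\<lambda>p. c p 0 0 0"])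
      show "finite I" using L by (simp add: I_def finite_PiE)
      show "polyfun3 (G p)" for p
        unfolding G_def case_prod_unfold by (rule polyfun3_wq)
      show "((\<lambda>s. c p (s * a) (s * b) s) \<longlongrightarrow> c p 0 0 0) (at_right 0)" for p a b
        unfolding c_def case_prod_unfold loop_weight_def
        by (intro tendsto_prod) (auto intro!: tendsto_eq_intros)
      \<comment> \<open>At the base point the vertices 1, 2, 3 have weights 1/10, 1/5, 3/10 and any
        other number gets 2/5 by default, so every factor is positive for every \<phi>.\<close>
      show "c p 0 0 0 > 0" for p
        unfolding c_def case_prod_unfold by (intro prod_pos) (auto simp: loop_weight_def)
      show "((\<lambda>s. (\<Sum>p\<in>I. c p (s * a) (s * b) s * (G p (s * a) (s * b) s)\<^sup>2) / s ^ 6) \<longlongrightarrow>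
          schur (a\<^sup>2) (b\<^sup>2) 1) (at_right 0)" for a b
        using robinson_param_limit[of a b] unfolding sos .
    \<comment> \<open>At the eight outer grid points the arguments of \<open>schur\<close> are
      \<open>(1, 1, 1)\<close>, \<open>(1, 0, 1)\<close> or \<open>(0, 1, 1)\<close>, and it
      vanishes at each.\<close>
    qed (auto simp: schur_def)
    \<comment> \<open>At the center the value is \<open>schur 0 0 1 = 1\<close>.\<close>
    then show False by (simp add: schur_def)
  qed
  then show ?thesis using x by blast
qed

end
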